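(* Let $\mathcal{H}$ (with function $f_{\mathcal H}$) be a template of arity $k$, let $T=T(\mathcal{H})$ be the model completion of $T_0(\mathcal{H})$, and let $\varphi(x,y_0,\dots,y_{k-2})=R(x,y_0,\dots,y_{k-2})$. Then $(T,\varphi)$ has the pseudo-nfcp.
   Context: **$k$-full hypergraphs.** A pair $(H,E)$ with $E\subseteq H^k$ is a $k$-full hypergraph if $E=E^*\cup E^{<k}$ is a partition where $E^*$ is symmetric and holds only on $k$-tuples of $k$ distinct elements, and $E^{<k}$ is the set of all $k$-tuples from $H$ with fewer than $k$ distinct entries. **Templates.** A template of arity $k$ ($2\le k<\omega$) is a sequence $\mathcal{H}=\langle \mathbf{h}_n:n<\omega\rangle$ together with a function $f_{\mathcal H}:\omega\to\omega\setminus\{0\}$ such that: (0) $\lim_{n\to\infty} f_{\mathcal H}(n)=\infty$; (1) for all $n$, $\mathbf{h}_n=(H_n,E_n)$ is a finite $k$-full hypergraph, whose vertex set is identified with $\{0,\dots,H_n-1\}$ (the symbol $H_n$ is used both for the vertex set and for its cardinality $\|\mathbf{h}_n\|$); (2) $f_{\mathcal H}(n)\le H_n<\aleph_0$; (3) (Extension) with $t=f_{\mathcal H}(n)$, for any vertices $i^0_0,\dots,i^0_{k-2},\dots,i^{t-1}_0,\dots,i^{t-1}_{k-2}\in H_n$ there is $s\in H_n$ with $\langle s,i^\ell_0,\dots,i^\ell_{k-2}\rangle\in E_n$ for all $\ell<t$. **The tree.** $X_{\mathcal H}$ is the set of finite sequences $\rho$ of natural numbers with $\rho(n)<H_n$ for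 all $n<\mathrm{lgn}(\rho)$, where $\mathrm{lgn}$ denotes length. $\eta\trianglelefteq\nu$ means $\eta$ is an initial segment of $\nu$. **The theory $T_0=T_0(\mathcal H)$.** Its language has equality, a $k$-place relation $R$, and unary predicates $Q_\eta$ for $\eta\in X_{\mathcal H}$. Its axioms state: (i) $R$ is symmetric and holds only on $k$-tuples of distinct elements; (ii) $\forall x\,Q_{\langle\rangle}(x)$, and $\forall x(Q_\nu(x)\to Q_\eta(x))$ whenever $\eta\trianglelefteq\nu\in X_{\mathcal H}$; (iii) for each $\eta\in X_{\mathcal H}$ of length $m$, the predicates $Q_{\eta^{\frown}\langle i\rangle}$, $i<\|\mathbf{h}_m\|$, partition $Q_\eta$ (where $\eta^{\frown}\langle i\rangle$ is the concatenation of $\eta$ with the one-term sequence $\langle i\rangle$); (iv) for all $\eta_0,\dots,\eta_{k-1}\in X_{\mathcal H}$ and $n<\min_i \mathrm{lgn}(\eta_i)$, if $\langle\eta_0(n),\dots,\eta_{k-1}(n)\rangle\notin E_n$ then $\forall x_0\dots x_{k-1}\,(Q_{\eta_0}(x_0)\wedge\dots\wedge Q_{\eta_{k-1}}(x_{k-1})\to\neg R(x_0,\dots,x_{k-1}))$. $T_0$ has a model completion $T=T(\mathcal H)$, which is complete and eliminates quantifiers. **Pseudo-nfcp.** Let $T$ be a complete theory with monster model $\mathfrak{C}_T$ and $\varphi(\bar x,\bar y)$ a formula. Let $\mathcal{P}$ be the set of complete types $p(\bar y)$ over $\emptyset$ containing $\exists\bar x\,\varphi(\bar x,\bar y)$.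 $(T,\varphi)$ has the pseudo-nfcp when $T$ is countable and one can assign to each $p\in\mathcal{P}$ a function $f_p:\omega\to\omega$ such that, writing $f_{\bar a}$ for $f_p$ when $p=\mathrm{tp}(\bar a)\in\mathcal{P}$: (1) (continuity) for each $m<\omega$ and $p\in\mathcal P$, if $f_p(m)=r$ then for some $\psi(\bar y)\in p$, every $q\in\mathcal{P}$ with $\psi\in q$ satisfies $f_q(m)=r$; (2) for every $s\ge1$ there is $n<\omega$ such that whenever $\bar a_0,\dots,\bar a_{s-1},\bar b_0,\dots,\bar b_{s-1}$ are tuples from $\mathfrak{C}_T$ realizing types in $\mathcal{P}$ with $f_{\bar a_\ell}\upharpoonright n=f_{\bar b_\ell}\upharpoonright n$ for all $\ell<s$, and $\{\varphi(\bar x,\bar a_\ell):\ell<s\}$ is a partial type (i.e. consistent), then $\{\varphi(\bar x,\bar b_\ell):\ell<s\}$ is also a partial type. *)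

theory Defs
  imports Complex_Main "HOL-Library.Multiset" "HOL-Library.Countable_Set" "HOL-Library.Sublist"
begin

section \<open>First-order logic over relational languages\<close>

text \<open>A language assigns an arity to each of its relation symbols; equality is logical.
  Variables are named by natural numbers.\<close>

type_synonym 's lang = "'s \<Rightarrow> nat option"

datatype 's fm =
    Fls
  | Eq nat nat
  | Rel 's "nat list"
  | Neg "'s fm"
  | Conj "'s fm" "'s fm"
  | Ex nat "'s fm"

definition Disj :: "'s fm \<Rightarrow> 's fm \<Rightarrow> 's fm" where
  "Disj \<phi> \<psi> = Neg (Conj (Neg \<phi>) (Neg \<psi>))"

definition Impl :: "'s fm \<Rightarrow> 's fm \<Rightarrow> 's fm" where
  "Impl \<phi> \<psi> = Neg (Conj \<phi> (Neg \<psi>))"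

definition All :: "nat \<Rightarrow> 's fm \<Rightarrow> 's fm" where
  "All x \<phi> = Neg (Ex x (Neg \<phi>))"

definition Conjs :: "'s fm list \<Rightarrow> 's fm" where
  "Conjs \<phi>s = foldr Conj \<phi>s (Neg Fls)"

definition Disjs :: "'s fm list \<Rightarrow> 's fm" where
  "Disjs \<phi>s = foldr Disj \<phi>s Fls"

definition Exs :: "nat list \<Rightarrow> 's fm \<Rightarrow> 's fm" where
  "Exs xs \<phi> = foldr Ex xs \<phi>"

definition Alls :: "nat list \<Rightarrow> 's fm \<Rightarrow> 's fm" where
  "Alls xs \<phi> = foldr All xs \<phi>"

primrec fv :: "'s fm \<Rightarrow> nat set" where
  "fv Fls = {}"
| "fv (Eq x y) = {x, y}"
| "fv (Rel s xs) = set xs"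
| "fv (Neg \<phi>) = fv \<phi>"
| "fv (Conj \<phi> \<psi>) = fv \<phi> \<union> fv \<psi>"
| "fv (Ex x \<phi>) = fv \<phi> - {x}"

primrec wf_fm :: "'s lang \<Rightarrow> 's fm \<Rightarrow> bool" where
  "wf_fm L Fls \<longleftrightarrow> True"
| "wf_fm L (Eq x y) \<longleftrightarrow> True"
| "wf_fm L (Rel s xs) \<longleftrightarrow> L s = Some (length xs)"
| "wf_fm L (Neg \<phi>) \<longleftrightarrow> wf_fm L \<phi>"
| "wf_fm L (Conj \<phi> \<psi>) \<longleftrightarrow> wf_fm L \<phi> \<and> wf_fm L \<psi>"
| "wf_fm L (Ex x \<phi>) \<longleftrightarrow> wf_fm L \<phi>"

definition fms_in :: "'s lang \<Rightarrow> nat list \<Rightarrow> 's fm set" where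
  "fms_in L ys = {\<psi>. wf_fm L \<psi> \<and> fv \<psi> \<subseteq> set ys}"

definition sentences :: "'s lang \<Rightarrow> 's fm set" where
  "sentences L = fms_in L []"

text \<open>Values of \<open>rel\<close> at symbols outside the language, or at tuples that leave the universe
  or have the wrong length, are never consulted.\<close>

record ('s, 'u) struct =
  univ :: "'u set"
  rel :: "'s \<Rightarrow> 'u list \<Rightarrow> bool"

primrec sat :: "('s, 'u) struct \<Rightarrow> (nat \<Rightarrow> 'u) \<Rightarrow> 's fm \<Rightarrow> bool" where
  "sat M v Fls \<longleftrightarrow> False"
| "sat M v (Eq x y) \<longleftrightarrow> v x = v y"
| "sat M v (Rel s xs) \<longleftrightarrow> rel M s (map v xs)"
| "sat M v (Neg \<phi>) \<longleftrightarrow> \<not> sat M v \<phi>"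
| "sat M v (Conj \<phi> \<psi>) \<longleftrightarrow> sat M v \<phi> \<and> sat M v \<psi>"
| "sat M v (Ex x \<phi>) \<longleftrightarrow> (\<exists>a\<in>univ M. sat M (v(x := a)) \<phi>)"

definition tuples :: "'a set \<Rightarrow> nat \<Rightarrow> 'a list set" where
  "tuples A n = {as. length as = n \<and> set as \<subseteq> A}"

definition env :: "nat list \<Rightarrow> 'u list \<Rightarrow> nat \<Rightarrow> 'u" where
  "env ys as y = the (map_of (zip ys as) y)"

definition models :: "('s, 'u) struct \<Rightarrow> 's fm set \<Rightarrow> bool" where
  "models M T \<longleftrightarrow> univ M \<noteq> {} \<and> (\<forall>\<sigma>\<in>T. \<forall>v. range v \<subseteq> univ M \<longrightarrow> sat M v \<sigma>)"

definition embedding :: "'s lang \<Rightarrow> ('s, 'u) struct \<Rightarrow> ('s, 'u) struct \<Rightarrow> ('u \<Rightarrow> 'u) \<Rightarrow> bool" where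
  "embedding L M N e \<longleftrightarrow>
     e ` univ M \<subseteq> univ N \<and> inj_on e (univ M) \<and>
     (\<forall>s n. L s = Some n \<longrightarrow> (\<forall>as\<in>tuples (univ M) n. rel M s as \<longleftrightarrow> rel N s (map e as)))"

definition automorphism :: "'s lang \<Rightarrow> ('s, 'u) struct \<Rightarrow> ('u \<Rightarrow> 'u) \<Rightarrow> bool" where
  "automorphism L M h \<longleftrightarrow> embedding L M M h \<and> h ` univ M = univ M"


section \<open>Theories, model completions, types\<close>

text \<open>HOL cannot quantify over structures of all types at once, so the notions below range over
  the structures whose universe is a nonempty subset of a type \<open>'u\<close>. For a countable language and
  an infinite type \<open>'u\<close> they agree with the usual notions by the Loewenheim-Skolem and
  compactness theorems; for a finite \<open>'u\<close> they would not be meaningful.\<close>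

definition complete_theory :: "'u itself \<Rightarrow> 's lang \<Rightarrow> 's fm set \<Rightarrow> bool" where
  "complete_theory (_ :: 'u itself) L T \<longleftrightarrow>
     T \<subseteq> sentences L \<and>
     (\<exists>M :: ('s, 'u) struct. models M T) \<and>
     (\<forall>\<sigma>\<in>sentences L.
        (\<forall>M :: ('s, 'u) struct. models M T \<longrightarrow> models M {\<sigma>}) \<or>
        (\<forall>M :: ('s, 'u) struct. models M T \<longrightarrow> models M {Neg \<sigma>}))"

text \<open>\<open>T\<close> is a model completion of \<open>T0\<close>: \<open>T\<close> extends \<open>T0\<close>, every model of \<open>T0\<close> embeds into a model
  of \<open>T\<close>, and for every model \<open>M\<close> of \<open>T0\<close> the union of \<open>T\<close> with the diagram of \<open>M\<close> is complete.
  A model of that union is a model \<open>N\<close> of \<open>T\<close> together with an embedding of \<open>M\<close>, a sentence of its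
  language is a formula with parameters from \<open>M\<close>, and the last clause spells out completeness
  in these terms.\<close>

definition model_completion :: "'u itself \<Rightarrow> 's lang \<Rightarrow> 's fm set \<Rightarrow> 's fm set \<Rightarrow> bool" where
  "model_completion (_ :: 'u itself) L T0 T \<longleftrightarrow>
     T0 \<subseteq> sentences L \<and> T \<subseteq> sentences L \<and>
     (\<forall>M :: ('s, 'u) struct. models M T \<longrightarrow> models M T0) \<and>
     (\<forall>M :: ('s, 'u) struct. models M T0 \<longrightarrow>
        (\<exists>(N :: ('s, 'u) struct) e. models N T \<and> embedding L M N e)) \<and>
     (\<forall>(M :: ('s, 'u) struct) (N1 :: ('s, 'u) struct) (N2 :: ('s, 'u) struct) e1 e2.
        models M T0 \<longrightarrow>
        models N1 T \<longrightarrow> embedding L M N1 e1 \<longrightarrow>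
        models N2 T \<longrightarrow> embedding L M N2 e2 \<longrightarrow>
        (\<forall>\<psi> v. wf_fm L \<psi> \<longrightarrow> range v \<subseteq> univ M \<longrightarrow>
           (sat N1 (e1 \<circ> v) \<psi> \<longleftrightarrow> sat N2 (e2 \<circ> v) \<psi>)))"

text \<open>Complete types over the empty set in the variables \<open>ys\<close>.\<close>

definition complete_types :: "'u itself \<Rightarrow> 's lang \<Rightarrow> 's fm set \<Rightarrow> nat list \<Rightarrow> 's fm set set" where
  "complete_types (_ :: 'u itself) L T ys =
     {p. p \<subseteq> fms_in L ys \<and>
         (\<forall>p0. finite p0 \<longrightarrow> p0 \<subseteq> p \<longrightarrow>
            (\<exists>M :: ('s, 'u) struct. models M T \<and>
               (\<exists>as\<in>tuples (univ M) (length ys). \<forall>\<psi>\<in>p0. sat M (env ys as) \<psi>))) \<and>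
         (\<forall>\<psi>\<in>fms_in L ys. \<psi> \<in> p \<or> Neg \<psi> \<in> p)}"

definition tp :: "'s lang \<Rightarrow> ('s, 'u) struct \<Rightarrow> nat list \<Rightarrow> 'u list \<Rightarrow> 's fm set" where
  "tp L M ys as = {\<psi> \<in> fms_in L ys. sat M (env ys as) \<psi>}"

text \<open>A monster model is a model that is \<open>\<kappa>\<close>-saturated and strongly \<open>\<kappa>\<close>-homogeneous for a large
  cardinal parameter \<open>\<kappa>\<close>. Only countable languages matter here, and only \<open>\<kappa> = \<aleph>\<^sub>1\<close> (parameter sets
  are countable) is demanded, which every choice of an uncountable \<open>\<kappa>\<close> implies. A formula over \<open>A\<close> is
  represented by a formula together with a valuation in \<open>A\<close>; the type variable is variable 0.\<close>

definition saturated :: "'s lang \<Rightarrow> ('s, 'u) struct \<Rightarrow> bool" where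
  "saturated L C \<longleftrightarrow>
     (\<forall>A \<Phi>. countable A \<longrightarrow> A \<subseteq> univ C \<longrightarrow>
        \<Phi> \<subseteq> {(\<psi>, v). wf_fm L \<psi> \<and> range v \<subseteq> A} \<longrightarrow>
        (\<forall>\<Phi>0. finite \<Phi>0 \<longrightarrow> \<Phi>0 \<subseteq> \<Phi> \<longrightarrow>
           (\<exists>a\<in>univ C. \<forall>(\<psi>, v)\<in>\<Phi>0. sat C (v(0 := a)) \<psi>)) \<longrightarrow>
        (\<exists>a\<in>univ C. \<forall>(\<psi>, v)\<in>\<Phi>. sat C (v(0 := a)) \<psi>))"

definition strongly_homogeneous :: "'s lang \<Rightarrow> ('s, 'u) struct \<Rightarrow> bool" where
  "strongly_homogeneous L C \<longleftrightarrow>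
     (\<forall>A g. countable A \<longrightarrow> A \<subseteq> univ C \<longrightarrow> g ` A \<subseteq> univ C \<longrightarrow>
        (\<forall>\<psi> v. wf_fm L \<psi> \<longrightarrow> range v \<subseteq> A \<longrightarrow> (sat C v \<psi> \<longleftrightarrow> sat C (g \<circ> v) \<psi>)) \<longrightarrow>
        (\<exists>h. automorphism L C h \<and> (\<forall>a\<in>A. h a = g a)))"

definition monster_model :: "'s lang \<Rightarrow> 's fm set \<Rightarrow> ('s, 'u) struct \<Rightarrow> bool" where
  "monster_model L T C \<longleftrightarrow> models C T \<and> saturated L C \<and> strongly_homogeneous L C"

text \<open>The set of formulas \<open>\<phi>(xs, as)\<close> with \<open>as \<in> As\<close> is a partial type, i.e. it is
  consistent with the elementary diagram of \<open>C\<close>.\<close>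

definition partial_type ::
  "('s, 'u) struct \<Rightarrow> 's fm \<Rightarrow> nat list \<Rightarrow> nat list \<Rightarrow> 'u list set \<Rightarrow> bool" where
  "partial_type C \<phi> xs ys As \<longleftrightarrow>
     (\<forall>A0. finite A0 \<longrightarrow> A0 \<subseteq> As \<longrightarrow>
        (\<exists>cs\<in>tuples (univ C) (length xs). \<forall>as\<in>A0. sat C (env (xs @ ys) (cs @ as)) \<phi>))"


section \<open>Pseudo-nfcp\<close>

text \<open>The formula is \<open>\<phi>(xs, ys)\<close>. A function on all sets of formulas is used for the assignment of
  \<open>f p\<close> to the types \<open>p \<in> nfcp_types\<close>; its other values are irrelevant.\<close>

definition nfcp_types ::
  "'u itself \<Rightarrow> 's lang \<Rightarrow> 's fm set \<Rightarrow> 's fm \<Rightarrow> nat list \<Rightarrow> nat list \<Rightarrow> 's fm set set" where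
  "nfcp_types U L T \<phi> xs ys = {p \<in> complete_types U L T ys. Exs xs \<phi> \<in> p}"

definition pseudo_nfcp ::
  "'s lang \<Rightarrow> 's fm set \<Rightarrow> ('s, 'u) struct \<Rightarrow> 's fm \<Rightarrow> nat list \<Rightarrow> nat list \<Rightarrow> bool" where
  "pseudo_nfcp L T (C :: ('s, 'u) struct) \<phi> xs ys \<longleftrightarrow>
     complete_theory TYPE('u) L T \<and> monster_model L T C \<and>
     distinct (xs @ ys) \<and> \<phi> \<in> fms_in L (xs @ ys) \<and>
     countable (dom L) \<and>
     (\<exists>f :: 's fm set \<Rightarrow> nat \<Rightarrow> nat.
        (let P = nfcp_types TYPE('u) L T \<phi> xs ys in
        (\<forall>m. \<forall>p\<in>P. \<forall>r. f p m = r \<longrightarrow> (\<exists>\<psi>\<in>p. \<forall>q\<in>P. \<psi> \<in> q \<longrightarrow> f q m = r)) \<and>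
        (\<forall>s::nat. s \<ge> 1 \<longrightarrow> (\<exists>n. \<forall>a b.
           (\<forall>l<s. a l \<in> tuples (univ C) (length ys) \<and> tp L C ys (a l) \<in> P \<and>
                  b l \<in> tuples (univ C) (length ys) \<and> tp L C ys (b l) \<in> P \<and>
                  (\<forall>m<n. f (tp L C ys (a l)) m = f (tp L C ys (b l)) m)) \<longrightarrow>
           partial_type C \<phi> xs ys (a ` {..<s}) \<longrightarrow>
           partial_type C \<phi> xs ys (b ` {..<s})))))"


section \<open>Templates and their theories\<close>

definition symmetric :: "'a list set \<Rightarrow> bool" where
  "symmetric E \<longleftrightarrow> (\<forall>as bs. as \<in> E \<longrightarrow> mset bs = mset as \<longrightarrow> bs \<in> E)"

definition full_hypergraph :: "nat \<Rightarrow> 'a set \<Rightarrow> 'a list set \<Rightarrow> bool" where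
  "full_hypergraph k H E \<longleftrightarrow>
     (\<exists>Estar Elt. E = Estar \<union> Elt \<and> Estar \<inter> Elt = {} \<and>
        Estar \<subseteq> {as \<in> tuples H k. distinct as} \<and> symmetric Estar \<and>
        Elt = {as \<in> tuples H k. card (set as) < k})"

text \<open>The \<open>n\<close>-th hypergraph has vertex set \<open>{..<size_at \<H> n}\<close> and edge set \<open>edges \<H> n\<close>.\<close>

record template =
  size_at :: "nat \<Rightarrow> nat"
  edges :: "nat \<Rightarrow> nat list set"
  growth :: "nat \<Rightarrow> nat"

definition is_template :: "nat \<Rightarrow> template \<Rightarrow> bool" where
  "is_template k \<H> \<longleftrightarrow>
     2 \<le> k \<and>
     (\<forall>n. growth \<H> n \<noteq> 0) \<and>
     filterlim (growth \<H>) at_top sequentially \<and>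
     (\<forall>n. full_hypergraph k {..<size_at \<H> n} (edges \<H> n)) \<and>
     (\<forall>n. growth \<H> n \<le> size_at \<H> n) \<and>
     (\<forall>n i. (\<forall>l<growth \<H> n. i l \<in> tuples {..<size_at \<H> n} (k - 1)) \<longrightarrow>
        (\<exists>s<size_at \<H> n. \<forall>l<growth \<H> n. s # i l \<in> edges \<H> n))"

definition tree :: "template \<Rightarrow> nat list set" where
  "tree \<H> = {\<rho>. \<forall>n<length \<rho>. \<rho> ! n < size_at \<H> n}"

datatype sym = SymR | SymQ "nat list"

definition lang_of :: "nat \<Rightarrow> template \<Rightarrow> sym lang" where
  "lang_of k \<H> s =
     (case s of SymR \<Rightarrow> Some k | SymQ \<eta> \<Rightarrow> (if \<eta> \<in> tree \<H> then Some 1 else None))"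

abbreviation Q :: "nat list \<Rightarrow> nat \<Rightarrow> sym fm" where
  "Q \<eta> x \<equiv> Rel (SymQ \<eta>) [x]"

abbreviation R :: "nat list \<Rightarrow> sym fm" where
  "R xs \<equiv> Rel SymR xs"

definition R_axioms :: "nat \<Rightarrow> sym fm set" where
  "R_axioms k =
     {Alls [0..<k] (Impl (R [0..<k]) (R zs)) | zs. mset zs = mset [0..<k]} \<union>
     {Alls [0..<k] (Impl (R [0..<k]) (Neg (Eq i j))) | i j. i < j \<and> j < k}"

definition tree_axioms :: "template \<Rightarrow> sym fm set" where
  "tree_axioms \<H> =
     {All 0 (Q [] 0)} \<union>
     {All 0 (Impl (Q \<nu> 0) (Q \<eta> 0)) | \<nu> \<eta>. \<nu> \<in> tree \<H> \<and> prefix \<eta> \<nu>}"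

text \<open>The cells of a partition may be empty, so these axioms are universal.\<close>

definition partition_axioms :: "template \<Rightarrow> sym fm set" where
  "partition_axioms \<H> =
     {All 0 (Impl (Q \<eta> 0) (Disjs (map (\<lambda>i. Q (\<eta> @ [i]) 0) [0..<size_at \<H> (length \<eta>)])))
        | \<eta>. \<eta> \<in> tree \<H>} \<union>
     {All 0 (Impl (Q (\<eta> @ [i]) 0) (Q \<eta> 0))
        | \<eta> i. \<eta> \<in> tree \<H> \<and> i < size_at \<H> (length \<eta>)} \<union>
     {All 0 (Neg (Conj (Q (\<eta> @ [i]) 0) (Q (\<eta> @ [j]) 0)))
        | \<eta> i j. \<eta> \<in> tree \<H> \<and> i < size_at \<H> (length \<eta>) \<and> j < size_at \<H> (length \<eta>) \<and> i \<noteq> j}"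

definition edge_axioms :: "nat \<Rightarrow> template \<Rightarrow> sym fm set" where
  "edge_axioms k \<H> =
     {Alls [0..<k] (Impl (Conjs (map (\<lambda>i. Q (\<eta>s ! i) i) [0..<k])) (Neg (R [0..<k])))
        | \<eta>s n. \<eta>s \<in> tuples (tree \<H>) k \<and> (\<forall>\<eta>\<in>set \<eta>s. n < length \<eta>) \<and>
                map (\<lambda>\<eta>. \<eta> ! n) \<eta>s \<notin> edges \<H> n}"

definition T0 :: "nat \<Rightarrow> template \<Rightarrow> sym fm set" where
  "T0 k \<H> = R_axioms k \<union> tree_axioms \<H> \<union> partition_axioms \<H> \<union> edge_axioms k \<H>"

end

theory Submission
  imports Defs
begin

text \<open>A model of \<open>T0\<close> amounts to a symmetric irreflexive relation \<open>R\<close> on a set whose points are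
  coloured by branches of the tree, such that at each level the colours of an \<open>R\<close>-tuple form an
  edge. Hence \<open>R(x, b\<^sub>0), \<dots>, R(x, b\<^sub>s\<^sub>-\<^sub>1)\<close> have a common solution in some extension of the model
  as soon as a branch for \<open>x\<close> can be chosen, level by level, that forms edges with the
  colours of all \<open>b\<^sub>l\<close>. At levels where the growth function is at least \<open>s\<close> the extension property of
  the template provides a choice, so only finitely many levels matter, and there it suffices to
  copy the colours of a solution for tuples with the same colours. So \<open>f\<^sub>p(m)\<close> may
  be taken to code the colours of \<open>p\<close> up to level \<open>m\<close>. Embeddings between models of the model
  completion are elementary, so that solutions in extensions reflect down to the monster model.\<close>

section \<open>Validity and satisfaction\<close>

text \<open>Quantifying over all valuations makes outer universal quantifiers invisible, so the
  axioms of \<open>T0\<close>, which are universal, can be handled through their quantifier-free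
  matrices.\<close>

definition valid :: "('s, 'u) struct \<Rightarrow> 's fm \<Rightarrow> bool" where
  "valid M \<phi> \<longleftrightarrow> (\<forall>v. range v \<subseteq> univ M \<longrightarrow> sat M v \<phi>)"

lemma models_iff_valid: "models M T \<longleftrightarrow> univ M \<noteq> {} \<and> (\<forall>\<sigma>\<in>T. valid M \<sigma>)"
  by (simp add: models_def valid_def)

lemma valid_All: "valid M (All x \<phi>) \<longleftrightarrow> valid M \<phi>"
proof
  assume l: "valid M (All x \<phi>)"
  show "valid M \<phi>"
    unfolding valid_def
  proof (intro allI impI)
    fix v :: "nat \<Rightarrow> _" assume v: "range v \<subseteq> univ M"
    then have "sat M v (All x \<phi>)" and "v x \<in> univ M" using l by (auto simp: valid_def)
    then have "sat M (v(x := v x)) \<phi>" unfolding All_def sat.simps by blast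
    then show "sat M v \<phi>" by simp
  qed
next
  assume r: "valid M \<phi>"
  show "valid M (All x \<phi>)"
    unfolding valid_def
  proof (intro allI impI)
    fix v :: "nat \<Rightarrow> _" assume v: "range v \<subseteq> univ M"
    have "range (v(x := a)) \<subseteq> univ M" if "a \<in> univ M" for a using v that by auto
    then show "sat M v (All x \<phi>)" using r unfolding valid_def All_def by auto
  qed
qed

lemma valid_Alls: "valid M (Alls xs \<phi>) \<longleftrightarrow> valid M \<phi>"
  unfolding Alls_def by (induction xs) (simp_all add: valid_All)

lemma valid_All_const: "valid M (All x \<phi>) \<Longrightarrow> a \<in> univ M \<Longrightarrow> sat M (\<lambda>_. a) \<phi>"
  unfolding valid_All unfolding valid_def by (simp add: image_subset_iff)

lemma sat_Impl [simp]: "sat M v (Impl \<phi> \<psi>) \<longleftrightarrow> (sat M v \<phi> \<longrightarrow> sat M v \<psi>)"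
  by (simp add: Impl_def)

lemma sat_Conjs [simp]: "sat M v (Conjs \<phi>s) \<longleftrightarrow> (\<forall>\<phi>\<in>set \<phi>s. sat M v \<phi>)"
  unfolding Conjs_def by (induction \<phi>s) simp_all

lemma sat_Disjs [simp]: "sat M v (Disjs \<phi>s) \<longleftrightarrow> (\<exists>\<phi>\<in>set \<phi>s. sat M v \<phi>)"
  unfolding Disjs_def by (induction \<phi>s) (simp_all add: Disj_def)

lemma wf_fm_Conjs [simp]: "wf_fm L (Conjs \<phi>s) \<longleftrightarrow> (\<forall>\<phi>\<in>set \<phi>s. wf_fm L \<phi>)"
  unfolding Conjs_def by (induction \<phi>s) simp_all

lemma fv_Conjs [simp]: "fv (Conjs \<phi>s) = (\<Union>\<phi>\<in>set \<phi>s. fv \<phi>)"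
  unfolding Conjs_def by (induction \<phi>s) simp_all

lemma sat_cong: "(\<And>x. x \<in> fv \<phi> \<Longrightarrow> v x = w x) \<Longrightarrow> sat M v \<phi> \<longleftrightarrow> sat M w \<phi>"
proof (induction \<phi> arbitrary: v w)
  case (Rel s xs)
  then have "map v xs = map w xs" by simp
  then show ?case by (simp only: sat.simps)
next
  case (Ex x \<phi>)
  have "sat M (v(x := a)) \<phi> \<longleftrightarrow> sat M (w(x := a)) \<phi>" for a
    by (rule Ex.IH) (use Ex.prems in auto)
  then show ?case by simp
next
  case (Conj \<phi>1 \<phi>2)
  then show ?case by (metis UnCI fv.simps(5) sat.simps(5))
next
  case (Neg \<phi>)
  then show ?case by (metis fv.simps(4) sat.simps(4))
qed auto

lemma map_env: "distinct ys \<Longrightarrow> length ys = length as \<Longrightarrow> map (env ys as) ys = as"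
  by (rule nth_equalityI) (simp_all add: env_def map_of_zip_nth)

text \<open>Variable 0 is reserved for the point to be solved for, so the parameter at position
  \<open>j\<close> sits in variable \<open>Suc j\<close>.\<close>

lemma env_upt: "length as = k - 1 \<Longrightarrow> j < k - 1 \<Longrightarrow> env [1..<k] as (Suc j) = as ! j"
  using map_of_zip_nth[of "[1..<k]" as j] by (simp add: env_def)

lemma map_env_upd:
  assumes "length as = k - 1" and "k \<ge> 1"
  shows "map ((env [1..<k] as)(0 := c)) [0..<k] = c # as"
proof -
  have "[0..<k] = 0 # [1..<k]" using assms by (simp add: upt_conv_Cons)
  moreover have "map ((env [1..<k] as)(0 := c)) [1..<k] = map (env [1..<k] as) [1..<k]"
    by simp
  moreover have "map (env [1..<k] as) [1..<k] = as" using assms by (intro map_env) auto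
  ultimately show ?thesis by simp
qed

section \<open>Coloured structures\<close>

definition branch_prefix :: "(nat \<Rightarrow> nat) \<Rightarrow> nat \<Rightarrow> nat list" where
  "branch_prefix \<beta> n = map \<beta> [0..<n]"

lemma length_branch_prefix [simp]: "length (branch_prefix \<beta> n) = n"
  by (simp add: branch_prefix_def)

lemma nth_branch_prefix [simp]: "i < n \<Longrightarrow> branch_prefix \<beta> n ! i = \<beta> i"
  by (simp add: branch_prefix_def)

lemma branch_prefix_Suc: "branch_prefix \<beta> (Suc n) = branch_prefix \<beta> n @ [\<beta> n]"
  by (simp add: branch_prefix_def)

lemma prefix_branch_prefix:
  assumes "prefix \<eta> (branch_prefix \<beta> n)"
  shows "\<eta> = branch_prefix \<beta> (length \<eta>)"
proof (rule nth_equalityI)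
  fix i assume "i < length \<eta>"
  then show "\<eta> ! i = branch_prefix \<beta> (length \<eta>) ! i"
    using assms prefix_length_le[OF assms]
    by (auto simp: prefix_def) (metis nth_append nth_branch_prefix order.strict_trans2)
qed simp

lemma branch_prefix_in_tree: "(\<And>n. \<beta> n < size_at \<H> n) \<Longrightarrow> branch_prefix \<beta> n \<in> tree \<H>"
  by (simp add: tree_def)

text \<open>Finiteness of the levels later allows all colour formulas of one level to be decided by
  a single finite part of a type.\<close>

lemma finite_tree_level: "finite {\<eta> \<in> tree \<H>. length \<eta> = n}"
proof (rule finite_subset)
  show "{\<eta> \<in> tree \<H>. length \<eta> = n} \<subseteq> {\<eta>. set \<eta> \<subseteq> (\<Union>i<n. {..<size_at \<H> i}) \<and> length \<eta> = n}"
    by (fastforce simp: tree_def in_set_conv_nth)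
  show "finite {\<eta>. set \<eta> \<subseteq> (\<Union>i<n. {..<size_at \<H> i}) \<and> length \<eta> = n}"
    by (rule finite_lists_length_eq) simp
qed

text \<open>For a nonempty universe, the existence of such a \<open>\<beta>\<close> is equivalent to
  being a model of \<open>T0\<close>; \<open>models_T0_coloured\<close> and
  \<open>coloured_models_T0\<close> give the two directions. Models can then be built and inspected
  without touching formulas.\<close>

definition coloured :: "nat \<Rightarrow> template \<Rightarrow> (sym, 'u) struct \<Rightarrow> ('u \<Rightarrow> nat \<Rightarrow> nat) \<Rightarrow> bool" where
  "coloured k \<H> M \<beta> \<longleftrightarrow>
     (\<forall>a\<in>univ M. \<forall>n. \<beta> a n < size_at \<H> n) \<and>
     (\<forall>a\<in>univ M. \<forall>\<eta>\<in>tree \<H>. rel M (SymQ \<eta>) [a] \<longleftrightarrow> \<eta> = branch_prefix (\<beta> a) (length \<eta>)) \<and>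
     (\<forall>as\<in>tuples (univ M) k. rel M SymR as \<longrightarrow>
        distinct as \<and> (\<forall>bs. mset bs = mset as \<longrightarrow> rel M SymR bs) \<and>
        (\<forall>n. map (\<lambda>a. \<beta> a n) as \<in> edges \<H> n))"

lemma
  assumes "coloured k \<H> M \<beta>"
  shows coloured_less: "a \<in> univ M \<Longrightarrow> \<beta> a n < size_at \<H> n"
    and coloured_Q: "a \<in> univ M \<Longrightarrow> \<eta> \<in> tree \<H> \<Longrightarrow>
          rel M (SymQ \<eta>) [a] \<longleftrightarrow> \<eta> = branch_prefix (\<beta> a) (length \<eta>)"
    and coloured_distinct: "as \<in> tuples (univ M) k \<Longrightarrow> rel M SymR as \<Longrightarrow> distinct as"
    and coloured_sym: "as \<in> tuples (univ M) k \<Longrightarrow> rel M SymR as \<Longrightarrow> mset bs = mset as \<Longrightarrow>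
          rel M SymR bs"
    and coloured_edges: "as \<in> tuples (univ M) k \<Longrightarrow> rel M SymR as \<Longrightarrow>
          map (\<lambda>a. \<beta> a n) as \<in> edges \<H> n"
  using assms unfolding coloured_def by blast+

lemma append_in_tree: "\<eta> @ [i] \<in> tree \<H> \<longleftrightarrow> \<eta> \<in> tree \<H> \<and> i < size_at \<H> (length \<eta>)"
  by (auto simp: tree_def nth_append less_Suc_eq split: if_splits)

text \<open>The symmetry axioms permute variables, whereas symmetry of a relation permutes values.
  Removing one preimage of the head at a time lifts a permutation of values to one of
  variables.\<close>

lemma mset_eq_map:
  "mset bs = mset (map v xs) \<Longrightarrow> \<exists>zs. mset zs = mset xs \<and> bs = map v zs"
proof (induction bs arbitrary: xs)
  case (Cons b bs)
  then have "b \<in> set (map v xs)" by (metis list.set_intros(1) set_mset_mset)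
  then obtain x where x: "x \<in> set xs" "b = v x" by auto
  have "mset (x # remove1 x xs) = mset xs" using x(1) by simp
  then have "mset (map v xs) = mset (map v (x # remove1 x xs))" by (metis mset_map)
  then have "mset bs = mset (map v (remove1 x xs))" using Cons.prems x(2) by simp
  then obtain zs where zs: "mset zs = mset (remove1 x xs)" "bs = map v zs" using Cons.IH by blast
  then have "mset (x # zs) = mset xs \<and> b # bs = map v (x # zs)" using x by simp
  then show ?case by (rule exI)
qed simp

text \<open>Variables from \<open>k\<close> on receive an arbitrary point of the universe, whence
  the nonemptiness assumption.\<close>

lemma valid_tuple:
  assumes "valid M \<phi>" and "as \<in> tuples (univ M) k" and "univ M \<noteq> {}"
  shows "\<exists>v. range v \<subseteq> univ M \<and> map v [0..<k] = as \<and> sat M v \<phi>"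
proof -
  obtain z where z: "z \<in> univ M" using assms(3) by blast
  define v where "v i = (if i < k then as ! i else z)" for i
  have as: "length as = k" "set as \<subseteq> univ M" using assms(2) by (auto simp: tuples_def)
  have "map v [0..<k] = as" by (rule nth_equalityI) (simp_all add: as v_def)
  moreover have "range v \<subseteq> univ M" using as z by (auto simp: v_def)
  ultimately show ?thesis using assms(1) unfolding valid_def by blast
qed

section \<open>Models of \<open>T0\<close> as coloured structures\<close>

text \<open>The partition axioms give every node that holds at a point a successor that also holds
  there, so a branch can be climbed. Disjointness of siblings and closure under prefixes exclude all
  nodes off this branch.\<close>

lemma models_T0_coloured:
  fixes M :: "(sym, 'u) struct"
  assumes "models M (T0 k \<H>)"
  shows "\<exists>\<beta>. coloured k \<H> M \<beta>"
proof -
  have ne: "univ M \<noteq> {}" and ax: "\<And>\<sigma>. \<sigma> \<in> T0 k \<H> \<Longrightarrow> valid M \<sigma>"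
    using assms by (auto simp: models_iff_valid)
  have root: "rel M (SymQ []) [a]" if "a \<in> univ M" for a
  proof -
    have "All 0 (Q [] 0) \<in> T0 k \<H>" by (simp add: T0_def tree_axioms_def)
    then have "sat M (\<lambda>_. a) (Q [] 0)" using that by (intro valid_All_const ax)
    then show ?thesis by simp
  qed
  have down: "rel M (SymQ \<eta>) [a]"
    if "a \<in> univ M" "\<nu> \<in> tree \<H>" "prefix \<eta> \<nu>" "rel M (SymQ \<nu>) [a]" for a \<nu> \<eta>
  proof -
    have "All 0 (Impl (Q \<nu> 0) (Q \<eta> 0)) \<in> T0 k \<H>"
      using that by (auto simp: T0_def tree_axioms_def)
    then have "sat M (\<lambda>_. a) (Impl (Q \<nu> 0) (Q \<eta> 0))"
      using that(1) by (intro valid_All_const ax)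
    then show ?thesis using that by simp
  qed
  have step: "\<exists>i<size_at \<H> (length \<eta>). rel M (SymQ (\<eta> @ [i])) [a]"
    if "a \<in> univ M" "\<eta> \<in> tree \<H>" "rel M (SymQ \<eta>) [a]" for a \<eta>
  proof -
    let ?\<phi> = "Impl (Q \<eta> 0) (Disjs (map (\<lambda>i. Q (\<eta> @ [i]) 0) [0..<size_at \<H> (length \<eta>)]))"
    have "All 0 ?\<phi> \<in> T0 k \<H>"
      using that by (auto simp: T0_def partition_axioms_def)
    then have "sat M (\<lambda>_. a) ?\<phi>"
      using that(1) by (intro valid_All_const ax)
    then show ?thesis using that by auto
  qed
  have disj: "i = j"
    if "a \<in> univ M" "\<eta> \<in> tree \<H>" "i < size_at \<H> (length \<eta>)" "j < size_at \<H> (length \<eta>)"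
      "rel M (SymQ (\<eta> @ [i])) [a]" "rel M (SymQ (\<eta> @ [j])) [a]" for a \<eta> i j
  proof (rule ccontr)
    assume "i \<noteq> j"
    let ?\<phi> = "Neg (Conj (Q (\<eta> @ [i]) 0) (Q (\<eta> @ [j]) 0))"
    have "All 0 ?\<phi> \<in> T0 k \<H>"
      using that \<open>i \<noteq> j\<close> by (auto simp: T0_def partition_axioms_def)
    then have "sat M (\<lambda>_. a) ?\<phi>"
      using that(1) by (intro valid_All_const ax)
    then show False using that by simp
  qed
  \<comment> \<open>Successors are chosen recursively: \<open>path a n\<close> is the node reached
    at level \<open>n\<close>, and \<open>\<beta> a n\<close> is the entry appended to it
    next.\<close>
  define path where "path a = rec_nat []
    (\<lambda>_ \<eta>. \<eta> @ [SOME i. i < size_at \<H> (length \<eta>) \<and> rel M (SymQ (\<eta> @ [i])) [a]])" for a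
  define \<beta> where "\<beta> a n =
    (SOME i. i < size_at \<H> (length (path a n)) \<and> rel M (SymQ (path a n @ [i])) [a])" for a n
  have path: "path a n = branch_prefix (\<beta> a) n" for a n
    by (induction n) (simp_all add: path_def \<beta>_def branch_prefix_def)
  \<comment> \<open>Node and next entry are carried together: the choice is meaningful only once the
    node is known to hold at \<open>a\<close>, and it then provides the node of the next
    level.\<close>
  have inv: "branch_prefix (\<beta> a) n \<in> tree \<H> \<and> rel M (SymQ (branch_prefix (\<beta> a) n)) [a] \<and>
      \<beta> a n < size_at \<H> n \<and> rel M (SymQ (branch_prefix (\<beta> a) n @ [\<beta> a n])) [a]"
    if a: "a \<in> univ M" for a n
  proof (induction n)
    have *: "\<beta> a n < size_at \<H> n \<and> rel M (SymQ (branch_prefix (\<beta> a) n @ [\<beta> a n])) [a]"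
      if "branch_prefix (\<beta> a) n \<in> tree \<H>" "rel M (SymQ (branch_prefix (\<beta> a) n)) [a]" for n
      using someI_ex[OF step[OF a that, unfolded Bex_def]] by (simp add: \<beta>_def path)
    {
      case 0
      then show ?case using *[of 0] root[OF a] by (simp add: branch_prefix_def tree_def)
    next
      case (Suc n)
      then show ?case using *[of "Suc n"] by (simp add: branch_prefix_Suc append_in_tree)
    }
  qed
  have uniq: "\<eta> = branch_prefix (\<beta> a) (length \<eta>)"
    if "a \<in> univ M" "\<eta> \<in> tree \<H>" "rel M (SymQ \<eta>) [a]" for a \<eta>
    using that(2,3)
  proof (induction \<eta> rule: rev_induct)
    case Nil
    then show ?case by (simp add: branch_prefix_def)
  next
    case (snoc i \<eta>)
    have "rel M (SymQ \<eta>) [a]" using down[OF that(1) snoc.prems(1) _ snoc.prems(2)] by simp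
    then have \<eta>: "\<eta> = branch_prefix (\<beta> a) (length \<eta>)" "\<eta> \<in> tree \<H>" "i < size_at \<H> (length \<eta>)"
      using snoc by (auto simp: append_in_tree)
    have "i = \<beta> a (length \<eta>)"
      using disj[OF that(1) \<eta>(2,3) _ snoc.prems(2)] inv[OF that(1), of "length \<eta>"] \<eta>(1) by metis
    then show ?case using \<eta>(1) by (simp add: branch_prefix_Suc)
  qed
  have "distinct as \<and> (\<forall>bs. mset bs = mset as \<longrightarrow> rel M SymR bs) \<and>
      (\<forall>n. map (\<lambda>a. \<beta> a n) as \<in> edges \<H> n)"
    if as: "as \<in> tuples (univ M) k" and R: "rel M SymR as" for as
  proof (intro conjI allI impI)
    have len: "length as = k" and sub: "set as \<subseteq> univ M" using as by (auto simp: tuples_def)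
    show "distinct as"
      unfolding distinct_conv_nth
    proof (intro allI impI)
      have *: "as ! i \<noteq> as ! j" if "i < j" "j < k" for i j
      proof -
        have "Alls [0..<k] (Impl (R [0..<k]) (Neg (Eq i j))) \<in> T0 k \<H>"
          using that by (auto simp: T0_def R_axioms_def)
        then obtain v where v: "map v [0..<k] = as" "sat M v (Impl (R [0..<k]) (Neg (Eq i j)))"
          using valid_tuple[OF _ as ne] ax by (metis valid_Alls)
        have "as ! i = v i" "as ! j = v j" using that v(1) by auto
        then show ?thesis using v R by simp
      qed
      fix i j assume "i < length as" "j < length as" "i \<noteq> j"
      then show "as ! i \<noteq> as ! j" using *[of i j] *[of j i] len by (metis nat_neq_iff)
    qed
  next
    fix bs assume bs: "mset bs = mset as"
    \<comment> \<open>\<open>Neg Fls\<close> holds trivially; only a valuation representing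
      \<open>as\<close> is wanted, because the permutation \<open>zs\<close> of variables is found
      after \<open>v\<close> is fixed.\<close>
    obtain v where v: "range v \<subseteq> univ M" "map v [0..<k] = as"
      using valid_tuple[of M "Neg Fls", OF _ as ne] by (auto simp: valid_def)
    obtain zs where zs: "mset zs = mset [0..<k]" "bs = map v zs"
      using mset_eq_map bs v(2) by metis
    have "Alls [0..<k] (Impl (R [0..<k]) (R zs)) \<in> T0 k \<H>"
      using zs(1) by (auto simp: T0_def R_axioms_def)
    then have "sat M v (Impl (R [0..<k]) (R zs))"
      using v(1) by (metis ax valid_Alls valid_def)
    then show "rel M SymR bs" using v(2) zs(2) R by simp
  next
    fix n
    \<comment> \<open>\<open>Suc n\<close> is the least length at which the prefixes have an entry
      at level \<open>n\<close>.\<close>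
    let ?\<eta>s = "map (\<lambda>a. branch_prefix (\<beta> a) (Suc n)) as"
    let ?\<phi> = "Impl (Conjs (map (\<lambda>i. Q (?\<eta>s ! i) i) [0..<k])) (Neg (R [0..<k]))"
    have len: "length as = k" and sub: "set as \<subseteq> univ M" using as by (auto simp: tuples_def)
    show "map (\<lambda>a. \<beta> a n) as \<in> edges \<H> n"
    proof (rule ccontr)
      assume "map (\<lambda>a. \<beta> a n) as \<notin> edges \<H> n"
      then have "map (\<lambda>\<eta>. \<eta> ! n) ?\<eta>s \<notin> edges \<H> n" by (simp add: comp_def)
      moreover have "?\<eta>s \<in> tuples (tree \<H>) k"
        using len sub inv by (auto simp: tuples_def)
      moreover have "\<forall>\<eta>\<in>set ?\<eta>s. n < length \<eta>" by simp
      ultimately have "Alls [0..<k] ?\<phi> \<in> edge_axioms k \<H>"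
        unfolding edge_axioms_def mem_Collect_eq by (intro exI[of _ ?\<eta>s] exI[of _ n]) simp
      then have "Alls [0..<k] ?\<phi> \<in> T0 k \<H>" by (simp add: T0_def)
      then obtain v where v: "map v [0..<k] = as" "sat M v ?\<phi>"
        using valid_tuple[OF _ as ne] ax by (metis valid_Alls)
      have "rel M (SymQ (?\<eta>s ! i)) [v i]" if "i < k" for i
      proof -
        have "v i = as ! i" using that v(1) by auto
        moreover have "as ! i \<in> univ M" using that len sub by auto
        ultimately show ?thesis using that len inv[of "as ! i" "Suc n"] by simp
      qed
      then show False using v R by simp
    qed
  qed
  moreover have "rel M (SymQ \<eta>) [a] \<longleftrightarrow> \<eta> = branch_prefix (\<beta> a) (length \<eta>)"
    if "a \<in> univ M" "\<eta> \<in> tree \<H>" for a \<eta>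
    using inv[OF that(1), of "length \<eta>"] uniq[OF that] by auto
  ultimately have "coloured k \<H> M \<beta>"
    unfolding coloured_def using inv by blast
  then show ?thesis by blast
qed

text \<open>A node that holds at a point is an initial segment of its branch. Prefix and partition
  axioms follow directly, and the entries at \<open>n\<close> of the nodes in an edge axiom become
  the colours of the tuple at level \<open>n\<close>.\<close>

lemma coloured_models_T0:
  assumes "coloured k \<H> M \<beta>" and "univ M \<noteq> {}"
  shows "models M (T0 k \<H>)"
proof -
  note less = coloured_less[OF assms(1)] and Q = coloured_Q[OF assms(1)]
  have bp: "branch_prefix (\<beta> a) n \<in> tree \<H>" if "a \<in> univ M" for a n
    using less[OF that] by (rule branch_prefix_in_tree)
  have tup: "map v [0..<k] \<in> tuples (univ M) k" if "range v \<subseteq> univ M" for v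
    using that by (auto simp: tuples_def)
  have "valid M \<sigma>" if "\<sigma> \<in> R_axioms k" for \<sigma>
  proof -
    have "valid M (Impl (R [0..<k]) (R zs))" if "mset zs = mset [0..<k]" for zs
      unfolding valid_def
    proof (intro allI impI)
      fix v :: "nat \<Rightarrow> _" assume v: "range v \<subseteq> univ M"
      have "mset (map v zs) = mset (map v [0..<k])" using that by simp
      then show "sat M v (Impl (R [0..<k]) (R zs))"
        using coloured_sym[OF assms(1) tup[OF v]] by (simp del: mset_map)
    qed
    moreover have "valid M (Impl (R [0..<k]) (Neg (Eq i j)))" if "i < j" "j < k" for i j
      unfolding valid_def
    proof (intro allI impI)
      fix v :: "nat \<Rightarrow> _" assume v: "range v \<subseteq> univ M"
      show "sat M v (Impl (R [0..<k]) (Neg (Eq i j)))"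
        using coloured_distinct[OF assms(1) tup[OF v]] that
        by (fastforce simp: distinct_map inj_on_def)
    qed
    ultimately show ?thesis using that by (auto simp: R_axioms_def valid_Alls)
  qed
  moreover have "valid M \<sigma>" if "\<sigma> \<in> tree_axioms \<H>" for \<sigma>
  proof -
    have "valid M (Q [] 0)"
      using Q[of _ "[]"] by (auto simp: valid_def tree_def branch_prefix_def)
    moreover have "valid M (Impl (Q \<nu> 0) (Q \<eta> 0))" if "\<nu> \<in> tree \<H>" "prefix \<eta> \<nu>" for \<nu> \<eta>
      unfolding valid_def
    proof (intro allI impI)
      fix v :: "nat \<Rightarrow> _" assume v: "range v \<subseteq> univ M"
      then have v0: "v 0 \<in> univ M" by auto
      have "rel M (SymQ \<eta>) [v 0]" if "rel M (SymQ \<nu>) [v 0]"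
      proof -
        have "\<nu> = branch_prefix (\<beta> (v 0)) (length \<nu>)" using Q[OF v0 \<open>\<nu> \<in> tree \<H>\<close>] that by simp
        then have "\<eta> = branch_prefix (\<beta> (v 0)) (length \<eta>)"
          using prefix_branch_prefix \<open>prefix \<eta> \<nu>\<close> by metis
        then show ?thesis using Q[OF v0] bp[OF v0] by metis
      qed
      then show "sat M v (Impl (Q \<nu> 0) (Q \<eta> 0))" by simp
    qed
    ultimately show ?thesis using that by (auto simp: tree_axioms_def valid_All)
  qed
  moreover have "valid M \<sigma>" if "\<sigma> \<in> partition_axioms \<H>" for \<sigma>
  proof -
    have "valid M (Impl (Q \<eta> 0) (Disjs (map (\<lambda>i. Q (\<eta> @ [i]) 0) [0..<size_at \<H> (length \<eta>)])))"
      if "\<eta> \<in> tree \<H>" for \<eta>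
      unfolding valid_def
    proof (intro allI impI)
      fix v :: "nat \<Rightarrow> _" assume v: "range v \<subseteq> univ M"
      then have v0: "v 0 \<in> univ M" by auto
      let ?i = "\<beta> (v 0) (length \<eta>)"
      have "rel M (SymQ (\<eta> @ [?i])) [v 0]" if "rel M (SymQ \<eta>) [v 0]"
        using that Q[OF v0] \<open>\<eta> \<in> tree \<H>\<close> less[OF v0]
        by (simp add: append_in_tree branch_prefix_Suc)
      then show "sat M v (Impl (Q \<eta> 0) (Disjs (map (\<lambda>i. Q (\<eta> @ [i]) 0) [0..<size_at \<H> (length \<eta>)])))"
        using less[OF v0] by auto
    qed
    moreover have "valid M (Impl (Q (\<eta> @ [i]) 0) (Q \<eta> 0))"
      if "\<eta> \<in> tree \<H>" "i < size_at \<H> (length \<eta>)" for \<eta> i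
      unfolding valid_def
    proof (intro allI impI)
      fix v :: "nat \<Rightarrow> _" assume v: "range v \<subseteq> univ M"
      then have v0: "v 0 \<in> univ M" by auto
      show "sat M v (Impl (Q (\<eta> @ [i]) 0) (Q \<eta> 0))"
        using Q[OF v0, of "\<eta> @ [i]"] Q[OF v0, of \<eta>] that
        by (simp add: append_in_tree branch_prefix_Suc)
    qed
    moreover have "valid M (Neg (Conj (Q (\<eta> @ [i]) 0) (Q (\<eta> @ [j]) 0)))"
      if "\<eta> \<in> tree \<H>" "i < size_at \<H> (length \<eta>)" "j < size_at \<H> (length \<eta>)" "i \<noteq> j" for \<eta> i j
      unfolding valid_def
    proof (intro allI impI)
      fix v :: "nat \<Rightarrow> _" assume v: "range v \<subseteq> univ M"
      then have v0: "v 0 \<in> univ M" by auto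
      show "sat M v (Neg (Conj (Q (\<eta> @ [i]) 0) (Q (\<eta> @ [j]) 0)))"
        using Q[OF v0, of "\<eta> @ [i]"] Q[OF v0, of "\<eta> @ [j]"] that
        by (auto simp add: append_in_tree branch_prefix_Suc)
    qed
    ultimately show ?thesis using that by (auto simp: partition_axioms_def valid_All)
  qed
  moreover have "valid M \<sigma>" if \<sigma>_ax: "\<sigma> \<in> edge_axioms k \<H>" for \<sigma>
  proof -
    obtain \<eta>s n where \<eta>s: "\<eta>s \<in> tuples (tree \<H>) k" "\<forall>\<eta>\<in>set \<eta>s. n < length \<eta>"
        "map (\<lambda>\<eta>. \<eta> ! n) \<eta>s \<notin> edges \<H> n"
      and \<sigma>: "\<sigma> = Alls [0..<k] (Impl (Conjs (map (\<lambda>i. Q (\<eta>s ! i) i) [0..<k])) (Neg (R [0..<k])))"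
      using \<sigma>_ax by (auto simp: edge_axioms_def)
    have len: "length \<eta>s = k" "set \<eta>s \<subseteq> tree \<H>" using \<eta>s(1) by (auto simp: tuples_def)
    have "\<not> rel M SymR (map v [0..<k])"
      if v: "range v \<subseteq> univ M" and q: "\<forall>i<k. rel M (SymQ (\<eta>s ! i)) [v i]" for v
    proof
      assume "rel M SymR (map v [0..<k])"
      then have "map (\<lambda>a. \<beta> a n) (map v [0..<k]) \<in> edges \<H> n"
        using coloured_edges[OF assms(1) tup[OF v]] by blast
      moreover have "map (\<lambda>a. \<beta> a n) (map v [0..<k]) = map (\<lambda>\<eta>. \<eta> ! n) \<eta>s"
      proof (rule nth_equalityI)
        fix i assume "i < length (map (\<lambda>a. \<beta> a n) (map v [0..<k]))"
        then have i: "i < k" by simp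
        then have mem: "\<eta>s ! i \<in> set \<eta>s" using len by simp
        have "v i \<in> univ M" "\<eta>s ! i \<in> tree \<H>" "rel M (SymQ (\<eta>s ! i)) [v i]"
          using v q i mem len by auto
        then have "\<eta>s ! i = branch_prefix (\<beta> (v i)) (length (\<eta>s ! i))" using Q by blast
        moreover have "n < length (\<eta>s ! i)" using \<eta>s(2) mem by blast
        ultimately have "\<eta>s ! i ! n = \<beta> (v i) n" using nth_branch_prefix by metis
        then show "map (\<lambda>a. \<beta> a n) (map v [0..<k]) ! i = map (\<lambda>\<eta>. \<eta> ! n) \<eta>s ! i"
          using i len by simp
      qed (simp add: len)
      ultimately show False using \<eta>s(3) by simp
    qed
    then show ?thesis unfolding \<sigma> valid_Alls unfolding valid_def by simp
  qed
  ultimately show ?thesis using assms(2) by (auto simp: models_iff_valid T0_def)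
qed


section \<open>Constructing coloured structures\<close>

text \<open>Tuples with repetitions are also closed under permutation, since the multiset determines
  both the length and the set of entries.\<close>

lemma symmetric_edges:
  assumes "is_template k \<H>"
  shows "symmetric (edges \<H> n)"
proof -
  obtain Es El where E: "edges \<H> n = Es \<union> El" "symmetric Es"
      "El = {as \<in> tuples {..<size_at \<H> n} k. card (set as) < k}"
    using assms unfolding is_template_def full_hypergraph_def by metis
  have "symmetric El"
    unfolding symmetric_def E(3) tuples_def by (metis (lifting) mem_Collect_eq set_mset_mset size_mset)
  then show ?thesis using E(1,2) unfolding symmetric_def by blast
qed

lemma template_size_pos: "is_template k \<H> \<Longrightarrow> 0 < size_at \<H> n"
  unfolding is_template_def by (metis bot_nat_0.extremum_uniqueI gr0I)

text \<open>The colour predicates are unary, so they matter on one-element lists only; hence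
  \<open>hd\<close>.\<close>

definition colour_struct ::
  "'u set \<Rightarrow> ('u \<Rightarrow> nat \<Rightarrow> nat) \<Rightarrow> 'u list set \<Rightarrow> (sym, 'u) struct" where
  "colour_struct W \<beta> E =
     \<lparr>univ = W, rel = \<lambda>s as. case s of SymR \<Rightarrow> as \<in> E
                              | SymQ \<eta> \<Rightarrow> \<eta> = branch_prefix (\<beta> (hd as)) (length \<eta>)\<rparr>"

lemma colour_struct_simps [simp]:
  "univ (colour_struct W \<beta> E) = W"
  "rel (colour_struct W \<beta> E) SymR as \<longleftrightarrow> as \<in> E"
  "rel (colour_struct W \<beta> E) (SymQ \<eta>) as \<longleftrightarrow> \<eta> = branch_prefix (\<beta> (hd as)) (length \<eta>)"
  by (simp_all add: colour_struct_def)

lemma coloured_colour_struct: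
  assumes "\<And>a n. a \<in> W \<Longrightarrow> \<beta> a n < size_at \<H> n"
    and "\<And>as. as \<in> E \<Longrightarrow> distinct as"
    and "\<And>as bs. as \<in> E \<Longrightarrow> mset bs = mset as \<Longrightarrow> bs \<in> E"
    and "\<And>as n. as \<in> E \<Longrightarrow> map (\<lambda>a. \<beta> a n) as \<in> edges \<H> n"
  shows "coloured k \<H> (colour_struct W \<beta> E) \<beta>"
  using assms by (auto simp: coloured_def)

section \<open>Embeddings and elementarity\<close>

text \<open>Embeddings between structures over different types, as \<^const>\<open>embedding\<close> requires a
  single type of elements.\<close>

definition het_embedding ::
  "'s lang \<Rightarrow> ('s, 'u) struct \<Rightarrow> ('s, 'v) struct \<Rightarrow> ('u \<Rightarrow> 'v) \<Rightarrow> bool" where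
  "het_embedding L M N e \<longleftrightarrow>
     e ` univ M \<subseteq> univ N \<and> inj_on e (univ M) \<and>
     (\<forall>s n. L s = Some n \<longrightarrow> (\<forall>as\<in>tuples (univ M) n. rel M s as \<longleftrightarrow> rel N s (map e as)))"

lemma embedding_iff_het: "embedding L M N e \<longleftrightarrow> het_embedding L M N e"
  by (simp add: embedding_def het_embedding_def)

lemma het_embedding_comp:
  assumes "het_embedding L M N e" and "het_embedding L N P g"
  shows "het_embedding L M P (g \<circ> e)"
proof -
  have "map e as \<in> tuples (univ N) n" if "as \<in> tuples (univ M) n" for as n
    using that assms(1) by (auto simp: tuples_def het_embedding_def)
  moreover have "inj_on (g \<circ> e) (univ M)"
    using assms unfolding het_embedding_def by (meson comp_inj_on inj_on_subset)
  ultimately show ?thesis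
    using assms unfolding het_embedding_def
    by (auto simp flip: map_map simp: image_subset_iff)
qed

lemma het_embedding_colour_struct:
  assumes "coloured k \<H> M \<gamma>" and "g ` univ M \<subseteq> W" and "inj_on g (univ M)"
    and "\<And>a. a \<in> univ M \<Longrightarrow> \<beta> (g a) = \<gamma> a"
    and "\<And>as. as \<in> tuples (univ M) k \<Longrightarrow> rel M SymR as \<longleftrightarrow> map g as \<in> E"
  shows "het_embedding (lang_of k \<H>) M (colour_struct W \<beta> E) g"
  unfolding het_embedding_def
proof (intro conjI allI impI ballI)
  fix s n as assume s: "lang_of k \<H> s = Some n" and as: "as \<in> tuples (univ M) n"
  show "rel M s as \<longleftrightarrow> rel (colour_struct W \<beta> E) s (map g as)"
  proof (cases s)
    case SymR
    then show ?thesis using s as assms(5) by (simp add: lang_of_def)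
  next
    case (SymQ \<eta>)
    then have \<eta>: "\<eta> \<in> tree \<H>" "n = 1" using s by (auto simp: lang_of_def split: if_splits)
    then obtain a where a: "as = [a]" "a \<in> univ M"
      using as by (auto simp: tuples_def length_Suc_conv)
    show ?thesis using coloured_Q[OF assms(1) a(2) \<eta>(1)] assms(4)[OF a(2)] by (simp add: SymQ a(1))
  qed
qed (use assms in auto)

text \<open>Restricting to tuples from the universe discards the arbitrary values that
  \<open>rel M SymR\<close> may take elsewhere.\<close>

definition R_image :: "nat \<Rightarrow> (sym, 'u) struct \<Rightarrow> ('u \<Rightarrow> 'v) \<Rightarrow> 'v list set" where
  "R_image k M g = map g ` {as \<in> tuples (univ M) k. rel M SymR as}"

lemma map_in_R_image:
  assumes "inj_on g (univ M)" and "as \<in> tuples (univ M) k"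
  shows "map g as \<in> R_image k M g \<longleftrightarrow> rel M SymR as"
proof
  assume "map g as \<in> R_image k M g"
  then obtain cs where cs: "map g as = map g cs" "cs \<in> tuples (univ M) k" "rel M SymR cs"
    by (auto simp: R_image_def)
  have "inj_on g (set as \<union> set cs)"
    using assms cs(2) by (auto simp: tuples_def intro: inj_on_subset)
  then have "as = cs" using cs(1) by (rule map_inj_on[rotated])
  then show "rel M SymR as" using cs(3) by simp
qed (use assms(2) in \<open>auto simp: R_image_def\<close>)

text \<open>These facts verify the hypotheses of \<open>coloured_colour_struct\<close> for a copied
  relation. A permutation of an image tuple lifts to a permutation of the original one.\<close>

lemma
  assumes "coloured k \<H> M \<beta>" and "as \<in> R_image k M g"
  shows R_image_distinct: "inj_on g (univ M) \<Longrightarrow> distinct as"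
    and R_image_sym: "mset bs = mset as \<Longrightarrow> bs \<in> R_image k M g"
    and R_image_edges: "(\<And>a. a \<in> univ M \<Longrightarrow> \<delta> (g a) = \<beta> a) \<Longrightarrow>
          map (\<lambda>a. \<delta> a n) as \<in> edges \<H> n"
proof -
  obtain cs where cs: "as = map g cs" "cs \<in> tuples (univ M) k" "rel M SymR cs"
    using assms(2) by (auto simp: R_image_def)
  have sub: "set cs \<subseteq> univ M" using cs(2) by (simp add: tuples_def)
  show "distinct as" if "inj_on g (univ M)"
    using coloured_distinct[OF assms(1) cs(2,3)] inj_on_subset[OF that sub]
    by (simp add: cs(1) distinct_map)
  show "bs \<in> R_image k M g" if bs: "mset bs = mset as"
  proof -
    obtain ds where ds: "mset ds = mset cs" "bs = map g ds" using mset_eq_map bs cs(1) by metis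
    then have "ds \<in> tuples (univ M) k"
      using cs(2) mset_eq_length[OF ds(1)] mset_eq_setD[OF ds(1)] by (simp add: tuples_def)
    then show ?thesis using coloured_sym[OF assms(1) cs(2,3) ds(1)] ds(2) by (auto simp: R_image_def)
  qed
  show "map (\<lambda>a. \<delta> a n) as \<in> edges \<H> n" if "\<And>a. a \<in> univ M \<Longrightarrow> \<delta> (g a) = \<beta> a"
  proof -
    have "map (\<lambda>a. \<delta> a n) as = map (\<lambda>a. \<beta> a n) cs" using that sub by (auto simp: cs(1))
    then show ?thesis using coloured_edges[OF assms(1) cs(2,3)] by simp
  qed
qed

section \<open>Elementary embeddings, joint embedding and completeness\<close>

text \<open>The model completion speaks only about structures over \<open>'u\<close>, so
  \<open>D\<close> is first copied there along \<open>h\<close>, with its colours pulled back by the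
  inverse of \<open>h\<close>.\<close>

lemma T0_model_into_T:
  fixes D :: "(sym, 'v) struct" and h :: "'v \<Rightarrow> 'u"
  assumes "model_completion TYPE('u) (lang_of k \<H>) (T0 k \<H>) T"
    and "coloured k \<H> D \<beta>" and "univ D \<noteq> {}" and "inj h"
  shows "\<exists>(N :: (sym, 'u) struct) e. models N T \<and> het_embedding (lang_of k \<H>) D N e"
proof -
  let ?D = "colour_struct (h ` univ D) (\<beta> \<circ> inv h) (R_image k D h)"
  have inj: "inj_on h (univ D)" using assms(4) by (rule inj_on_subset) simp
  have "coloured k \<H> ?D (\<beta> \<circ> inv h)"
    using R_image_distinct[OF assms(2) _ inj] R_image_sym[OF assms(2)]
      R_image_edges[OF assms(2), of _ h "\<beta> \<circ> inv h"] coloured_less[OF assms(2)] assms(4)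
    by (intro coloured_colour_struct) auto
  then have "models ?D (T0 k \<H>)" using assms(3) by (intro coloured_models_T0) simp_all
  then obtain N e where "models N T" "embedding (lang_of k \<H>) ?D N e"
    using assms(1) unfolding model_completion_def by blast
  moreover have "het_embedding (lang_of k \<H>) D ?D h"
    using map_in_R_image[OF inj] inj assms(4)
    by (intro het_embedding_colour_struct[OF assms(2)]) auto
  ultimately show ?thesis
    using het_embedding_comp unfolding embedding_iff_het by blast
qed

text \<open>\<open>M\<close> is a model of \<open>S\<close> that embeds into the models
  \<open>M\<close> and \<open>N\<close> of \<open>T\<close>, by the identity and by
  \<open>e\<close>. Completeness of \<open>T\<close> with the diagram of \<open>M\<close> forces
  both to agree on formulas with parameters from \<open>M\<close>.\<close>

lemma model_completion_elementary:
  fixes M N :: "('s, 'u) struct"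
  assumes "model_completion TYPE('u) L S T" and "models M T" and "models N T"
    and "embedding L M N e" and "wf_fm L \<psi>" and "range v \<subseteq> univ M"
  shows "sat M v \<psi> \<longleftrightarrow> sat N (e \<circ> v) \<psi>"
proof -
  have "embedding L M M id" by (simp add: embedding_def)
  moreover have "models M S" using assms(1,2) unfolding model_completion_def by blast
  ultimately have "sat M (id \<circ> v) \<psi> \<longleftrightarrow> sat N (e \<circ> v) \<psi>"
    using assms unfolding model_completion_def by blast
  then show ?thesis by simp
qed

text \<open>The disjoint union works, with no \<open>R\<close>-tuple meeting both sides. Positivity
  of \<open>k\<close> rules out the empty tuple, the only one with equal images under
  \<open>Inl\<close> and \<open>Inr\<close>.\<close>

lemma coloured_joint_embedding:
  fixes M :: "(sym, 'v) struct" and N :: "(sym, 'w) struct"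
  assumes "coloured k \<H> M \<beta>" and "coloured k \<H> N \<gamma>" and "k > 0"
  shows "\<exists>D \<delta>. coloured k \<H> D \<delta> \<and> het_embedding (lang_of k \<H>) M D Inl \<and>
           het_embedding (lang_of k \<H>) N D Inr"
proof -
  let ?\<delta> = "case_sum \<beta> \<gamma>"
  let ?EM = "R_image k M (Inl :: 'v \<Rightarrow> 'v + 'w)" and ?EN = "R_image k N (Inr :: 'w \<Rightarrow> 'v + 'w)"
  let ?D = "colour_struct (Inl ` univ M \<union> Inr ` univ N) ?\<delta> (?EM \<union> ?EN)"
  note M = R_image_distinct[OF assms(1)] R_image_sym[OF assms(1)] R_image_edges[OF assms(1)]
  note N = R_image_distinct[OF assms(2)] R_image_sym[OF assms(2)] R_image_edges[OF assms(2)]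
  have "coloured k \<H> ?D ?\<delta>"
  proof (rule coloured_colour_struct)
    show "?\<delta> a n < size_at \<H> n" if "a \<in> Inl ` univ M \<union> Inr ` univ N" for a n
      using that coloured_less[OF assms(1)] coloured_less[OF assms(2)] by auto
    fix as assume as: "as \<in> ?EM \<union> ?EN"
    then show "distinct as" using M(1)[of as Inl] N(1)[of as Inr] by auto
    show "bs \<in> ?EM \<union> ?EN" if "mset bs = mset as" for bs
      using as M(2)[OF _ that, of Inl] N(2)[OF _ that, of Inr] by blast
    show "map (\<lambda>a. ?\<delta> a n) as \<in> edges \<H> n" for n
      using as M(3)[of as Inl ?\<delta>] N(3)[of as Inr ?\<delta>] by auto
  qed
  moreover have "het_embedding (lang_of k \<H>) M ?D Inl"
  proof (rule het_embedding_colour_struct[OF assms(1)])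
    show "rel M SymR as \<longleftrightarrow> map Inl as \<in> ?EM \<union> ?EN" if as: "as \<in> tuples (univ M) k" for as
    proof -
      have "map Inl as \<notin> ?EN"
        using as assms(3) by (cases as) (auto simp: R_image_def tuples_def)
      then show ?thesis using map_in_R_image[OF _ as, of Inl] by auto
    qed
  qed auto
  moreover have "het_embedding (lang_of k \<H>) N ?D Inr"
  proof (rule het_embedding_colour_struct[OF assms(2)])
    show "rel N SymR as \<longleftrightarrow> map Inr as \<in> ?EM \<union> ?EN" if as: "as \<in> tuples (univ N) k" for as
    proof -
      have "map Inr as \<notin> ?EM"
        using as assms(3) by (cases as) (auto simp: R_image_def tuples_def)
      then show ?thesis using map_in_R_image[OF _ as, of Inr] by auto
    qed
  qed auto
  ultimately show ?thesis by blast
qed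

text \<open>An infinite cardinal absorbs its double. Extensions are built on a sum type and return
  to \<open>'u\<close> along such an injection.\<close>

lemma infinite_inj_sum:
  assumes "infinite (UNIV :: 'u set)"
  shows "\<exists>h :: 'u + 'u \<Rightarrow> 'u. inj h"
proof -
  obtain h :: "'u + 'u \<Rightarrow> 'u" where "bij_betw h (UNIV <+> UNIV) UNIV"
    using card_of_ordIso[THEN iffD2, OF card_of_Plus_infinite1[OF assms card_of_mono1[OF subset_refl]]]
    by blast
  then show ?thesis using bij_betw_imp_inj_on by auto
qed

text \<open>Two models of \<open>T\<close> embed jointly into a coloured structure and from there
  into one model of \<open>T\<close>. Both embeddings are elementary, so the two models satisfy the
  same sentences; \<open>C\<close> witnesses consistency.\<close>

lemma model_completion_complete:
  fixes C :: "(sym, 'u) struct"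
  assumes "infinite (UNIV :: 'u set)" and "k > 0"
    and mc: "model_completion TYPE('u) (lang_of k \<H>) (T0 k \<H>) T" and "models C T"
  shows "complete_theory TYPE('u) (lang_of k \<H>) T"
proof -
  let ?L = "lang_of k \<H>"
  have agree: "sat M v \<sigma> \<longleftrightarrow> sat M' v' \<sigma>"
    if M: "models M T" "range v \<subseteq> univ M" and M': "models M' T" "range v' \<subseteq> univ M'"
      and \<sigma>: "\<sigma> \<in> sentences ?L" for M M' :: "(sym, 'u) struct" and v v' \<sigma>
  proof -
    have T0: "models K (T0 k \<H>)" if "models K T" for K :: "(sym, 'u) struct"
      using mc that unfolding model_completion_def by blast
    obtain \<beta> \<gamma> where "coloured k \<H> M \<beta>" "coloured k \<H> M' \<gamma>"
      using models_T0_coloured T0 M(1) M'(1) by blast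
    then obtain D :: "(sym, 'u + 'u) struct" and \<delta> where D: "coloured k \<H> D \<delta>"
        "het_embedding ?L M D Inl" "het_embedding ?L M' D Inr"
      using coloured_joint_embedding assms(2) by blast
    obtain h :: "'u + 'u \<Rightarrow> 'u" where h: "inj h" using infinite_inj_sum[OF assms(1)] by blast
    have "univ D \<noteq> {}" using D(2) M(2) unfolding het_embedding_def by auto
    then obtain N :: "(sym, 'u) struct" and e where N: "models N T" "het_embedding ?L D N e"
      using T0_model_into_T[OF mc D(1) _ h] by blast
    have wf: "wf_fm ?L \<sigma>" and closed: "fv \<sigma> = {}" using \<sigma> by (auto simp: sentences_def fms_in_def)
    have "sat M v \<sigma> \<longleftrightarrow> sat N ((e \<circ> Inl) \<circ> v) \<sigma>"
      using model_completion_elementary[OF mc M(1) N(1) _ wf M(2)]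
        het_embedding_comp[OF D(2) N(2)] unfolding embedding_iff_het by blast
    also have "\<dots> \<longleftrightarrow> sat N ((e \<circ> Inr) \<circ> v') \<sigma>"
      using closed by (intro sat_cong) auto
    also have "\<dots> \<longleftrightarrow> sat M' v' \<sigma>"
      using model_completion_elementary[OF mc M'(1) N(1) _ wf M'(2)]
        het_embedding_comp[OF D(3) N(2)] unfolding embedding_iff_het by blast
    finally show ?thesis .
  qed
  obtain c where c: "c \<in> univ C" using assms(4) by (auto simp: models_def)
  have "(\<forall>M :: (sym, 'u) struct. models M T \<longrightarrow> models M {\<sigma>}) \<or>
      (\<forall>M :: (sym, 'u) struct. models M T \<longrightarrow> models M {Neg \<sigma>})" if "\<sigma> \<in> sentences ?L" for \<sigma>
  proof -
    have "sat M v \<sigma> \<longleftrightarrow> sat C (\<lambda>_. c) \<sigma>" if "models M T" "range v \<subseteq> univ M"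
      for M :: "(sym, 'u) struct" and v
      using agree[OF that assms(4) _ \<open>\<sigma> \<in> sentences ?L\<close>] c by auto
    then show ?thesis by (cases "sat C (\<lambda>_. c) \<sigma>") (auto simp: models_def)
  qed
  then show ?thesis
    using mc assms(4) unfolding complete_theory_def model_completion_def by blast
qed


section \<open>Common solutions of finitely many instances of \<open>R\<close>\<close>

text \<open>A point \<open>z\<close> with branch \<open>\<zeta>\<close> is added, and the only new
  \<open>R\<close>-tuples are the permutations of \<open>z\<close> followed by a member of
  \<open>B\<close>. They all contain \<open>z\<close>, so \<open>R\<close> on \<open>M\<close> is
  unchanged; distinctness of the members of \<open>B\<close> keeps \<open>R\<close>
  irreflexive.\<close>

lemma one_point_extension:
  fixes M :: "(sym, 'v) struct"
  assumes tmpl: "is_template k \<H>" and col: "coloured k \<H> M \<beta>"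
    and \<zeta>: "\<And>n. \<zeta> n < size_at \<H> n"
    and edge: "\<And>b n. b \<in> B \<Longrightarrow> \<zeta> n # map (\<lambda>a. \<beta> a n) b \<in> edges \<H> n"
    and B: "\<And>b. b \<in> B \<Longrightarrow> b \<in> tuples (univ M) (k - 1) \<and> distinct b"
  shows "\<exists>(D :: (sym, 'v + 'v) struct) \<delta> z. coloured k \<H> D \<delta> \<and>
           het_embedding (lang_of k \<H>) M D Inl \<and> z \<in> univ D \<and>
           (\<forall>b\<in>B. rel D SymR (z # map Inl b))"
proof -
  \<comment> \<open>Any element of the right summand is new to the copy of \<open>M\<close>.\<close>
  let ?z = "Inr undefined :: 'v + 'v"
  let ?\<delta> = "case_sum \<beta> (\<lambda>_ :: 'v. \<zeta>)"
  let ?EM = "R_image k M (Inl :: 'v \<Rightarrow> 'v + 'v)"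
  let ?EB = "{as. \<exists>b\<in>B. mset as = mset (?z # map Inl b)}"
  let ?D = "colour_struct (insert ?z (Inl ` univ M)) ?\<delta> (?EM \<union> ?EB)"
  have EB: "distinct as" "map (\<lambda>a. ?\<delta> a n) as \<in> edges \<H> n" if as: "as \<in> ?EB" for as n
  proof -
    obtain b where b: "b \<in> B" "mset as = mset (?z # map Inl b)" using as by blast
    have "distinct (?z # map Inl b)" using B[OF b(1)] by (auto simp: distinct_map)
    then show "distinct as" using mset_eq_imp_distinct_iff[OF b(2)] by blast
    have "map (\<lambda>a. ?\<delta> a n) (?z # map Inl b) = \<zeta> n # map (\<lambda>a. \<beta> a n) b" by simp
    then have "map (\<lambda>a. ?\<delta> a n) (?z # map Inl b) \<in> edges \<H> n" using edge[OF b(1)]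
      by (simp add: comp_def)
    moreover have "mset (map (\<lambda>a. ?\<delta> a n) as) = mset (map (\<lambda>a. ?\<delta> a n) (?z # map Inl b))"
      using b(2) by (metis mset_map)
    ultimately show "map (\<lambda>a. ?\<delta> a n) as \<in> edges \<H> n"
      using symmetric_edges[OF tmpl] unfolding symmetric_def by blast
  qed
  have "coloured k \<H> ?D ?\<delta>"
  proof (rule coloured_colour_struct)
    show "?\<delta> a n < size_at \<H> n" if "a \<in> insert ?z (Inl ` univ M)" for a n
      using that coloured_less[OF col] \<zeta> by auto
    fix as assume as: "as \<in> ?EM \<union> ?EB"
    then show "distinct as" using R_image_distinct[OF col, of as Inl] EB(1)[of as] by auto
    show "bs \<in> ?EM \<union> ?EB" if "mset bs = mset as" for bs
      using as R_image_sym[OF col _ that, of Inl] that by auto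
    show "map (\<lambda>a. ?\<delta> a n) as \<in> edges \<H> n" for n
      using as R_image_edges[OF col, of as Inl ?\<delta>] EB(2)[of as n] by auto
  qed
  moreover have "het_embedding (lang_of k \<H>) M ?D Inl"
  proof (rule het_embedding_colour_struct[OF col])
    show "rel M SymR as \<longleftrightarrow> map Inl as \<in> ?EM \<union> ?EB" if as: "as \<in> tuples (univ M) k" for as
    proof -
      have "map Inl as \<notin> ?EB"
      proof
        assume "map Inl as \<in> ?EB"
        then obtain b where "mset (map Inl as) = mset (?z # map Inl b)" by blast
        then have "?z \<in> set (map Inl as)" using mset_eq_setD by fastforce
        then show False by auto
      qed
      then show ?thesis using map_in_R_image[OF _ as, of Inl] by auto
    qed
  qed auto
  moreover have "\<forall>b\<in>B. rel ?D SymR (?z # map Inl b)" by auto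
  moreover have "?z \<in> univ ?D" by simp
  ultimately show ?thesis by blast
qed

text \<open>The levels are independent of each other, so a vertex is found at each one separately:
  by assumption below \<open>N\<close>, by the extension property from \<open>N\<close> on.\<close>

lemma ex_common_branch:
  assumes tmpl: "is_template k \<H>" and col: "coloured k \<H> M \<beta>"
    and b: "\<And>l. l < s \<Longrightarrow> b l \<in> tuples (univ M) (k - 1)"
    and large: "\<And>n. n \<ge> N \<Longrightarrow> s \<le> growth \<H> n"
    and small: "\<And>n. n < N \<Longrightarrow>
          \<exists>x<size_at \<H> n. \<forall>l<s. x # map (\<lambda>a. \<beta> a n) (b l) \<in> edges \<H> n"
  shows "\<exists>\<zeta>. \<forall>n. \<zeta> n < size_at \<H> n \<and> (\<forall>l<s. \<zeta> n # map (\<lambda>a. \<beta> a n) (b l) \<in> edges \<H> n)"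
proof -
  have "\<exists>x<size_at \<H> n. \<forall>l<s. x # map (\<lambda>a. \<beta> a n) (b l) \<in> edges \<H> n" for n
  \<comment> \<open>For \<open>s = 0\<close> there is no tuple to pad with below, but any vertex
    will do.\<close>
  proof (cases "n < N \<or> s = 0")
    case True
    then show ?thesis using small template_size_pos[OF tmpl] by auto
  next
    case False
    \<comment> \<open>The extension property expects \<open>growth \<H> n\<close> tuples, possibly
      more than \<open>s\<close>; copies of \<open>b 0\<close> fill the surplus.\<close>
    define i where "i l = map (\<lambda>a. \<beta> a n) (b (if l < s then l else 0))" for l
    have "i l \<in> tuples {..<size_at \<H> n} (k - 1)" for l
    proof -
      have "b (if l < s then l else 0) \<in> tuples (univ M) (k - 1)" using b False by simp
      then show ?thesis using coloured_less[OF col] unfolding i_def tuples_def by fastforce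
    qed
    then obtain x where x: "x < size_at \<H> n" "\<forall>l<growth \<H> n. x # i l \<in> edges \<H> n"
      using tmpl unfolding is_template_def by blast
    have "x # map (\<lambda>a. \<beta> a n) (b l) \<in> edges \<H> n" if "l < s" for l
    proof -
      have "l < growth \<H> n" using large[of n] False that by simp
      then have "x # i l \<in> edges \<H> n" using x(2) by blast
      then show ?thesis using that by (simp add: i_def)
    qed
    then show ?thesis using x(1) by blast
  qed
  then show ?thesis by metis
qed

text \<open>A solution exists in a one-point extension of \<open>C\<close>, which embeds into a
  model \<open>N\<close> of \<open>T\<close>. The resulting embedding of \<open>C\<close> into
  \<open>N\<close> is elementary, so the existential formula expressing solvability already holds in
  \<open>C\<close>.\<close>

lemma R_solution_reflects:
  fixes C :: "(sym, 'u) struct" and s :: nat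
  assumes inf: "infinite (UNIV :: 'u set)" and tmpl: "is_template k \<H>"
    and mc: "model_completion TYPE('u) (lang_of k \<H>) (T0 k \<H>) T" and C: "models C T"
    and col: "coloured k \<H> C \<beta>"
    and b: "\<And>l. l < s \<Longrightarrow> b l \<in> tuples (univ C) (k - 1) \<and> distinct (b l)"
    and \<zeta>: "\<And>n. \<zeta> n < size_at \<H> n"
    and edge: "\<And>l n. l < s \<Longrightarrow> \<zeta> n # map (\<lambda>a. \<beta> a n) (b l) \<in> edges \<H> n"
  shows "\<exists>c\<in>univ C. \<forall>l<s. rel C SymR (c # b l)"
proof -
  have k: "k \<ge> 2" using tmpl by (simp add: is_template_def)
  obtain c0 where c0: "c0 \<in> univ C" using C by (auto simp: models_def)
  obtain D :: "(sym, 'u + 'u) struct" and \<delta> z where D: "coloured k \<H> D \<delta>"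
      "het_embedding (lang_of k \<H>) C D Inl" "z \<in> univ D" "\<forall>l<s. rel D SymR (z # map Inl (b l))"
  proof -
    have "\<exists>(D :: (sym, 'u + 'u) struct) \<delta> z. coloured k \<H> D \<delta> \<and>
        het_embedding (lang_of k \<H>) C D Inl \<and> z \<in> univ D \<and>
        (\<forall>a\<in>b ` {..<s}. rel D SymR (z # map Inl a))"
      by (rule one_point_extension[OF tmpl col \<zeta>]) (use b edge in blast)+
    then show ?thesis using that by blast
  qed
  obtain h :: "'u + 'u \<Rightarrow> 'u" where h: "inj h" using infinite_inj_sum[OF inf] by blast
  obtain N :: "(sym, 'u) struct" and e where N: "models N T" "het_embedding (lang_of k \<H>) D N e"
    using T0_model_into_T[OF mc D(1) _ h] D(3) by blast
  \<comment> \<open>All parameters go into one valuation: the variable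
    \<open>Suc (l * (k - 1) + j)\<close> carries entry \<open>j\<close> of \<open>b l\<close>,
    recovered by division with remainder. Variable 0 stays free for the solution, and variables
    beyond the last block get the default \<open>c0\<close>.\<close>
  define xs where "xs l = map (\<lambda>j. Suc (l * (k - 1) + j)) [0..<k - 1]" for l
  define v where "v n = (let l = (n - 1) div (k - 1) in
    if l < s then b l ! ((n - 1) mod (k - 1)) else c0)" for n
  have len: "length (b l) = k - 1" "set (b l) \<subseteq> univ C" if "l < s" for l
    using b[OF that] by (auto simp: tuples_def)
  have "v n \<in> univ C" for n
    using c0 len[of "(n - 1) div (k - 1)"] k by (auto simp: v_def Let_def subset_iff)
  then have v: "range v \<subseteq> univ C" by blast
  have vxs: "map v (xs l) = b l" if "l < s" for l
    using len[OF that] that by (intro nth_equalityI) (simp_all add: xs_def v_def)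
  define \<chi> where "\<chi> = Ex 0 (Conjs (map (\<lambda>l. R (0 # xs l)) [0..<s]))"
  have wf: "wf_fm (lang_of k \<H>) \<chi>" using k by (auto simp: \<chi>_def lang_of_def xs_def)
  have sat: "sat K w \<chi> \<longleftrightarrow> (\<exists>c\<in>univ K. \<forall>l<s. rel K SymR (c # map w (xs l)))"
    for K :: "(sym, 'u) struct" and w
  proof -
    have "sat K (w(0 := c)) (R (0 # xs l)) \<longleftrightarrow> rel K SymR (c # map w (xs l))" for c l
      by (simp add: xs_def comp_def)
    moreover have "sat K u (Conjs (map F [0..<s])) \<longleftrightarrow> (\<forall>l<s. sat K u (F l))" for u F by auto
    ultimately show ?thesis unfolding \<chi>_def by (simp only: sat.simps(6))
  qed
  have "rel N SymR (e z # map (e \<circ> Inl \<circ> v) (xs l))" if l: "l < s" for l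
  proof -
    have "z # map Inl (b l) \<in> tuples (univ D) k"
      using D(2,3) len[OF l] k by (auto simp: tuples_def het_embedding_def)
    moreover have "lang_of k \<H> SymR = Some k" by (simp add: lang_of_def)
    ultimately have "rel N SymR (map e (z # map Inl (b l)))"
      using N(2) D(4) l unfolding het_embedding_def by blast
    then show ?thesis by (simp add: vxs[OF l, symmetric] comp_assoc)
  qed
  moreover have "e z \<in> univ N" using N(2) D(3) by (auto simp: het_embedding_def)
  ultimately have "sat N ((e \<circ> Inl) \<circ> v) \<chi>" unfolding sat by blast
  moreover have "embedding (lang_of k \<H>) C N (e \<circ> Inl)"
    unfolding embedding_iff_het using D(2) N(2) by (rule het_embedding_comp)
  ultimately have "sat C v \<chi>" using model_completion_elementary[OF mc C N(1) _ wf v] by blast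
  then show ?thesis unfolding sat using vxs by auto
qed

section \<open>Colours of types\<close>

text \<open>Nodes of length \<open>Suc m\<close> record the colours at all levels up to and
  including \<open>m\<close>.\<close>

definition colour_vectors :: "nat \<Rightarrow> template \<Rightarrow> nat \<Rightarrow> nat list list set" where
  "colour_vectors k \<H> m = {\<eta>s \<in> tuples (tree \<H>) (k - 1). \<forall>\<eta>\<in>set \<eta>s. length \<eta> = Suc m}"

definition colour_fm :: "nat \<Rightarrow> nat list list \<Rightarrow> sym fm" where
  "colour_fm k \<eta>s = Conjs (map (\<lambda>j. Q (\<eta>s ! j) (Suc j)) [0..<k - 1])"

text \<open>The description is proper for complete types of \<open>T\<close> by
  \<open>ex1_colour_vector\<close>.\<close>

definition type_colour :: "nat \<Rightarrow> template \<Rightarrow> sym fm set \<Rightarrow> nat \<Rightarrow> nat list list" where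
  "type_colour k \<H> p m = (THE \<eta>s. \<eta>s \<in> colour_vectors k \<H> m \<and> colour_fm k \<eta>s \<in> p)"

lemma finite_colour_vectors: "finite (colour_vectors k \<H> m)"
proof (rule finite_subset)
  show "colour_vectors k \<H> m \<subseteq> {\<eta>s. set \<eta>s \<subseteq> {\<eta> \<in> tree \<H>. length \<eta> = Suc m} \<and> length \<eta>s = k - 1}"
    by (auto simp: colour_vectors_def tuples_def)
  show "finite {\<eta>s. set \<eta>s \<subseteq> {\<eta> \<in> tree \<H>. length \<eta> = Suc m} \<and> length \<eta>s = k - 1}"
    using finite_tree_level by (rule finite_lists_length_eq)
qed

lemma colour_fm_in_fms: "\<eta>s \<in> colour_vectors k \<H> m \<Longrightarrow> colour_fm k \<eta>s \<in> fms_in (lang_of k \<H>) [1..<k]"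
  by (auto simp: colour_vectors_def tuples_def colour_fm_def fms_in_def lang_of_def)

lemma colour_vector_of_tuple:
  assumes "coloured k \<H> M \<beta>" and "as \<in> tuples (univ M) (k - 1)"
  shows "map (\<lambda>a. branch_prefix (\<beta> a) (Suc m)) as \<in> colour_vectors k \<H> m"
  using assms coloured_less[OF assms(1)]
  by (auto simp: colour_vectors_def tuples_def intro!: branch_prefix_in_tree)

lemma sat_colour_fm:
  assumes "coloured k \<H> M \<beta>" and "as \<in> tuples (univ M) (k - 1)" and "\<eta>s \<in> colour_vectors k \<H> m"
  shows "sat M (env [1..<k] as) (colour_fm k \<eta>s) \<longleftrightarrow>
           \<eta>s = map (\<lambda>a. branch_prefix (\<beta> a) (Suc m)) as"
proof -
  have as: "length as = k - 1" "\<And>j. j < k - 1 \<Longrightarrow> as ! j \<in> univ M"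
    using assms(2) by (auto simp: tuples_def)
  have \<eta>s: "length \<eta>s = k - 1" "\<And>j. j < k - 1 \<Longrightarrow> \<eta>s ! j \<in> tree \<H> \<and> length (\<eta>s ! j) = Suc m"
    using assms(3) by (auto simp: colour_vectors_def tuples_def)
  have "sat M (env [1..<k] as) (colour_fm k \<eta>s) \<longleftrightarrow>
      (\<forall>j<k - 1. rel M (SymQ (\<eta>s ! j)) [env [1..<k] as (Suc j)])"
    by (auto simp: colour_fm_def)
  also have "\<dots> \<longleftrightarrow> (\<forall>j<k - 1. \<eta>s ! j = branch_prefix (\<beta> (as ! j)) (Suc m))"
    using env_upt[OF as(1)] coloured_Q[OF assms(1) as(2)] \<eta>s(2) by (metis (no_types, lifting))
  also have "\<dots> \<longleftrightarrow> \<eta>s = map (\<lambda>a. branch_prefix (\<beta> a) (Suc m)) as"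
    using as(1) \<eta>s(1) by (auto simp: list_eq_iff_nth_eq)
  finally show ?thesis .
qed

lemma ex1_colour_vector:
  assumes mc: "model_completion TYPE('u) (lang_of k \<H>) (T0 k \<H>) T"
    and p: "p \<in> complete_types TYPE('u) (lang_of k \<H>) T [1..<k]"
  shows "\<exists>!\<eta>s. \<eta>s \<in> colour_vectors k \<H> m \<and> colour_fm k \<eta>s \<in> p"
proof -
  \<comment> \<open>Types are only finitely satisfiable by definition, so \<open>p\<close> itself
    need not be realized. The finite part deciding all colour formulas of level \<open>m\<close> is,
    and the colours of its realization single out the vector.\<close>
  define p0 where "p0 = p \<inter> (colour_fm k ` colour_vectors k \<H> m \<union> Neg ` colour_fm k ` colour_vectors k \<H> m)"
  have "finite p0" "p0 \<subseteq> p" using finite_colour_vectors by (auto simp: p0_def)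
  then have "\<exists>M :: (sym, 'u) struct. models M T \<and>
      (\<exists>as\<in>tuples (univ M) (k - 1). \<forall>\<psi>\<in>p0. sat M (env [1..<k] as) \<psi>)"
    using p unfolding complete_types_def mem_Collect_eq length_upt by metis
  then obtain M :: "(sym, 'u) struct" and as where M: "models M T"
      "as \<in> tuples (univ M) (k - 1)" and sat: "\<And>\<psi>. \<psi> \<in> p0 \<Longrightarrow> sat M (env [1..<k] as) \<psi>"
    by blast
  have "models M (T0 k \<H>)" using mc M(1) unfolding model_completion_def by blast
  then obtain \<beta> where \<beta>: "coloured k \<H> M \<beta>" using models_T0_coloured by blast
  have eq: "colour_fm k \<eta>s \<in> p \<longleftrightarrow> \<eta>s = map (\<lambda>a. branch_prefix (\<beta> a) (Suc m)) as"
    if \<eta>s: "\<eta>s \<in> colour_vectors k \<H> m" for \<eta>s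
  proof -
    have "colour_fm k \<eta>s \<in> p \<or> Neg (colour_fm k \<eta>s) \<in> p"
      using p colour_fm_in_fms[OF \<eta>s] by (simp add: complete_types_def)
    moreover have "sat M (env [1..<k] as) (colour_fm k \<eta>s)" if "colour_fm k \<eta>s \<in> p"
      using sat[of "colour_fm k \<eta>s"] that \<eta>s by (simp add: p0_def)
    moreover have "\<not> sat M (env [1..<k] as) (colour_fm k \<eta>s)" if "Neg (colour_fm k \<eta>s) \<in> p"
      using sat[of "Neg (colour_fm k \<eta>s)"] that \<eta>s by (auto simp: p0_def)
    ultimately show ?thesis using sat_colour_fm[OF \<beta> M(2) \<eta>s] by blast
  qed
  show ?thesis
    using eq colour_vector_of_tuple[OF \<beta> M(2)] by blast
qed

lemma type_colour_tp:
  assumes "coloured k \<H> M \<beta>" and "as \<in> tuples (univ M) (k - 1)"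
  shows "type_colour k \<H> (tp (lang_of k \<H>) M [1..<k] as) m =
           map (\<lambda>a. branch_prefix (\<beta> a) (Suc m)) as"
  unfolding type_colour_def
  using sat_colour_fm[OF assms] colour_vector_of_tuple[OF assms, of m] colour_fm_in_fms
  by (intro the_equality) (auto simp: tp_def)

section \<open>Pseudo-nfcp for the relation \<open>R\<close>\<close>

theorem claim3p4:
  fixes k :: nat and \<H> :: template and T :: "sym fm set" and C :: "(sym, 'u) struct"
  assumes "infinite (UNIV :: 'u set)"
    and "is_template k \<H>"
    and "model_completion TYPE('u) (lang_of k \<H>) (T0 k \<H>) T"
    and "monster_model (lang_of k \<H>) T C"
  shows "pseudo_nfcp (lang_of k \<H>) T C (R [0..<k]) [0] [1..<k]"
proof -
  let ?L = "lang_of k \<H>" and ?\<phi> = "R [0..<k]"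
  let ?P = "nfcp_types TYPE('u) ?L T ?\<phi> [0] [1..<k]"
  \<comment> \<open>The colour vectors are coded injectively by numbers, as the functions of a type
    must be number-valued.\<close>
  define f where "f p m = to_nat (type_colour k \<H> p m)" for p m
  have k: "k \<ge> 2" using assms(2) by (simp add: is_template_def)
  then have vars: "[0] @ [1..<k] = [0..<k]" by (simp add: upt_conv_Cons)
  have C: "models C T" using assms(4) by (simp add: monster_model_def)
  then have "models C (T0 k \<H>)" using assms(3) unfolding model_completion_def by blast
  then obtain \<beta> where \<beta>: "coloured k \<H> C \<beta>" using models_T0_coloured by blast

  \<comment> \<open>The colour formula of \<open>p\<close> at level \<open>m\<close> serves as
    \<open>\<psi>\<close>: any type containing it has the same colour vector there.\<close>
  have continuity: "\<exists>\<psi>\<in>p. \<forall>q\<in>?P. \<psi> \<in> q \<longrightarrow> f q m = f p m" if "p \<in> ?P" for p m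
  proof -
    have ex1: "\<exists>!\<eta>s. \<eta>s \<in> colour_vectors k \<H> m \<and> colour_fm k \<eta>s \<in> q" if "q \<in> ?P" for q
      using that ex1_colour_vector[OF assms(3)] by (simp add: nfcp_types_def)
    have p: "type_colour k \<H> p m \<in> colour_vectors k \<H> m" "colour_fm k (type_colour k \<H> p m) \<in> p"
      using theI'[OF ex1[OF that]] by (simp_all add: type_colour_def)
    have "f q m = f p m" if "q \<in> ?P" "colour_fm k (type_colour k \<H> p m) \<in> q" for q
      using the1_equality[OF ex1[OF that(1)]] p(1) that(2) by (simp add: f_def type_colour_def)
    then show ?thesis using p(2) by blast
  qed

  \<comment> \<open>Types in \<open>?P\<close> contain the existential formula, so \<open>b\<close>
    extends to an \<open>R\<close>-tuple, and these have distinct entries. The one-point extension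
    depends on this.\<close>
  have distinct: "distinct b" if b: "b \<in> tuples (univ C) (k - 1)" "tp ?L C [1..<k] b \<in> ?P" for b
  proof -
    have len: "length b = k - 1" using b(1) by (simp add: tuples_def)
    have "sat C (env [1..<k] b) (Ex 0 ?\<phi>)"
      using b(2) by (simp add: nfcp_types_def tp_def Exs_def)
    then obtain c where c: "c \<in> univ C" "rel C SymR (c # b)"
      using map_env_upd[OF len] k by auto
    have "c # b \<in> tuples (univ C) k" using c(1) b(1) k by (auto simp: tuples_def)
    then show ?thesis using coloured_distinct[OF \<beta> _ c(2)] by simp
  qed

  \<comment> \<open>The family is finite, so consistency of its finite subfamilies amounts to one
    common solution in \<open>C\<close>.\<close>
  have partial: "partial_type C ?\<phi> [0] [1..<k] (b ` {..<s}) \<longleftrightarrow>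
      (\<exists>c\<in>univ C. \<forall>l<s. rel C SymR (c # b l))"
    if b: "\<And>l. l < s \<Longrightarrow> b l \<in> tuples (univ C) (k - 1)" for s and b :: "nat \<Rightarrow> 'u list"
  proof -
    have sat: "sat C (env ([0] @ [1..<k]) ([c] @ b l)) ?\<phi> \<longleftrightarrow> rel C SymR (c # b l)"
      if "l < s" for c l
    proof -
      have "map (env [0..<k] (c # b l)) [0..<k] = c # b l"
        using b[OF that] k by (intro map_env) (auto simp: tuples_def)
      then show ?thesis unfolding vars by simp
    qed
    show ?thesis
    proof
      assume "partial_type C ?\<phi> [0] [1..<k] (b ` {..<s})"
      then obtain cs where cs: "cs \<in> tuples (univ C) (length [0::nat])"
          "\<forall>as\<in>b ` {..<s}. sat C (env ([0] @ [1..<k]) (cs @ as)) ?\<phi>"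
        unfolding partial_type_def by blast
      then obtain c where "cs = [c]" "c \<in> univ C" by (auto simp: tuples_def length_Suc_conv)
      then show "\<exists>c\<in>univ C. \<forall>l<s. rel C SymR (c # b l)" using cs(2) sat by blast
    next
      assume "\<exists>c\<in>univ C. \<forall>l<s. rel C SymR (c # b l)"
      then obtain c where c: "c \<in> univ C" "\<forall>l<s. rel C SymR (c # b l)" by blast
      have "[c] \<in> tuples (univ C) (length [0::nat])" using c(1) by (simp add: tuples_def)
      moreover have "sat C (env ([0] @ [1..<k]) ([c] @ as)) ?\<phi>" if "as \<in> b ` {..<s}" for as
        using that c(2) sat by blast
      ultimately show "partial_type C ?\<phi> [0] [1..<k] (b ` {..<s})"
        unfolding partial_type_def by blast
    qed
  qed

  have transfer: "\<exists>n. \<forall>a b.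
      (\<forall>l<s. a l \<in> tuples (univ C) (length [1..<k]) \<and> tp ?L C [1..<k] (a l) \<in> ?P \<and>
             b l \<in> tuples (univ C) (length [1..<k]) \<and> tp ?L C [1..<k] (b l) \<in> ?P \<and>
             (\<forall>m<n. f (tp ?L C [1..<k] (a l)) m = f (tp ?L C [1..<k] (b l)) m)) \<longrightarrow>
      partial_type C ?\<phi> [0] [1..<k] (a ` {..<s}) \<longrightarrow>
      partial_type C ?\<phi> [0] [1..<k] (b ` {..<s})" for s :: nat
  proof -
    have "eventually (\<lambda>n. s \<le> growth \<H> n) sequentially"
      using assms(2) by (simp add: is_template_def filterlim_at_top)
    then obtain N where N: "\<And>n. n \<ge> N \<Longrightarrow> s \<le> growth \<H> n"
      \<comment> \<open>\<open>N\<close> depends on \<open>s\<close> alone, as the bound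
        \<open>n\<close> must be chosen before the tuples.\<close>
      unfolding eventually_sequentially by blast
    show ?thesis
    proof (intro exI[of _ N] allI impI)
      fix a b :: "nat \<Rightarrow> 'u list"
      assume ab: "\<forall>l<s. a l \<in> tuples (univ C) (length [1..<k]) \<and> tp ?L C [1..<k] (a l) \<in> ?P \<and>
             b l \<in> tuples (univ C) (length [1..<k]) \<and> tp ?L C [1..<k] (b l) \<in> ?P \<and>
             (\<forall>m<N. f (tp ?L C [1..<k] (a l)) m = f (tp ?L C [1..<k] (b l)) m)"
        and pa: "partial_type C ?\<phi> [0] [1..<k] (a ` {..<s})"
      have a: "a l \<in> tuples (univ C) (k - 1)" and b: "b l \<in> tuples (univ C) (k - 1)"
        and db: "distinct (b l)" if "l < s" for l
        using ab that distinct by simp_all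
      obtain c where c: "c \<in> univ C" "\<And>l. l < s \<Longrightarrow> rel C SymR (c # a l)"
        using pa partial[of s a, OF a] by blast
      \<comment> \<open>Injectivity of \<open>to_nat\<close> yields equal prefixes of length
        \<open>Suc n\<close>, whose last entries are the colours at level \<open>n\<close>.\<close>
      have same: "map (\<lambda>x. \<beta> x n) (a l) = map (\<lambda>x. \<beta> x n) (b l)" if "l < s" "n < N" for l n
      proof -
        have "f (tp ?L C [1..<k] (a l)) n = f (tp ?L C [1..<k] (b l)) n" using ab that by blast
        then have "map (\<lambda>x. branch_prefix (\<beta> x) (Suc n)) (a l) =
            map (\<lambda>x. branch_prefix (\<beta> x) (Suc n)) (b l)"
          unfolding f_def type_colour_tp[OF \<beta> a[OF that(1)]] type_colour_tp[OF \<beta> b[OF that(1)]]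
          by simp
        from arg_cong[OF this, of "map (\<lambda>\<eta>. \<eta> ! n)"] show ?thesis by (simp add: comp_def)
      qed
      \<comment> \<open>Below \<open>N\<close> the colour of the solution \<open>c\<close> works for
        the \<open>b l\<close> too, since it forms edges with the equal colours of the
        \<open>a l\<close>.\<close>
      have "\<exists>x<size_at \<H> n. \<forall>l<s. x # map (\<lambda>x. \<beta> x n) (b l) \<in> edges \<H> n" if "n < N" for n
      proof (intro exI conjI allI impI)
        show "\<beta> c n < size_at \<H> n" using coloured_less[OF \<beta> c(1)] .
        fix l assume l: "l < s"
        have "c # a l \<in> tuples (univ C) k" using c(1) a[OF l] k by (auto simp: tuples_def)
        then have "map (\<lambda>x. \<beta> x n) (c # a l) \<in> edges \<H> n"
          using coloured_edges[OF \<beta> _ c(2)[OF l]] by blast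
        then show "\<beta> c n # map (\<lambda>x. \<beta> x n) (b l) \<in> edges \<H> n" using same[OF l that] by simp
      qed
      from ex_common_branch[of k \<H> C \<beta> s b N, OF assms(2) \<beta> b N this]
      obtain \<zeta> where \<zeta>: "\<And>n. \<zeta> n < size_at \<H> n"
          "\<And>l n. l < s \<Longrightarrow> \<zeta> n # map (\<lambda>x. \<beta> x n) (b l) \<in> edges \<H> n"
        by blast
      have "\<exists>c\<in>univ C. \<forall>l<s. rel C SymR (c # b l)"
        by (rule R_solution_reflects[OF assms(1-3) C \<beta> _ \<zeta>]) (intro conjI b db)
      then show "partial_type C ?\<phi> [0] [1..<k] (b ` {..<s})" using partial[of s b, OF b] by blast
    qed
  qed

  have "countable (dom ?L)"
  proof (rule countable_subset)
    show "dom ?L \<subseteq> insert SymR (range SymQ)" by (auto intro: sym.exhaust)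
  qed simp
  moreover have "?\<phi> \<in> fms_in ?L ([0] @ [1..<k])"
    unfolding vars by (simp add: fms_in_def lang_of_def)
  moreover have "distinct ([0] @ [1..<k])" unfolding vars by simp
  moreover have "complete_theory TYPE('u) ?L T"
    using model_completion_complete[OF assms(1) _ assms(3) C] k by simp
  ultimately show ?thesis
    unfolding pseudo_nfcp_def Let_def using assms(4) continuity transfer by blast
qed

end
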